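(* There exist two nonempty $\Pi^0_1$ sets $A,B\subseteq\mathscr N=\omega^\omega$ such that there is no Hyp function $F:\mathscr N\to\mathscr N$ with $F[A]\subseteq B$, and no Hyp function $F:\mathscr N\to\mathscr N$ with $F[B]\subseteq A$.
   Context: Hyp means lightface $\Delta^1_1$. A function $F:\mathscr N\to\mathscr N$ is Hyp if its graph is a (lightface) $\Delta^1_1$ subset of $\mathscr N\times\mathscr N$. $\Pi^0_1$ means lightface $\Pi^0_1$ (effectively closed). *)

theory Defs
  imports Main "HOL-Library.Nat_Bijection"
begin

section \<open>Recursive functions on the natural numbers\<close>

text \<open>
  \<open>recursive_fn k f\<close>: the restriction of \<open>f\<close> to lists of length \<open>k\<close> is a total recursive
  \<open>k\<close>-ary function. The class is the least one containing zero, successor and the projections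
  and closed under composition, primitive recursion (on the first argument) and minimalization
  of regular functions. Values of \<open>f\<close> on lists of any other length are irrelevant.
\<close>

inductive recursive_fn :: "nat \<Rightarrow> (nat list \<Rightarrow> nat) \<Rightarrow> bool" where
  zero: "recursive_fn k (\<lambda>xs. 0)"
| succ: "recursive_fn 1 (\<lambda>xs. Suc (xs ! 0))"
| proj: "i < k \<Longrightarrow> recursive_fn k (\<lambda>xs. xs ! i)"
| comp: "recursive_fn (length gs) f \<Longrightarrow> \<forall>g\<in>set gs. recursive_fn k g \<Longrightarrow>
    recursive_fn k (\<lambda>xs. f (map (\<lambda>g. g xs) gs))"
| prim_rec: "recursive_fn k f \<Longrightarrow> recursive_fn (Suc (Suc k)) g \<Longrightarrow>
    recursive_fn (Suc k)
      (\<lambda>xs. rec_nat (f (tl xs)) (\<lambda>n r. g (n # r # tl xs)) (hd xs))"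
| minimalization: "recursive_fn (Suc k) g \<Longrightarrow> \<forall>xs. length xs = k \<longrightarrow> (\<exists>m. g (m # xs) = 0) \<Longrightarrow>
    recursive_fn k (\<lambda>xs. LEAST m. g (m # xs) = 0)"

definition rec_enumerable :: "nat set \<Rightarrow> bool" where
  "rec_enumerable W \<longleftrightarrow> (\<exists>f. recursive_fn 2 f \<and> W = {n. \<exists>m. f [n, m] = 0})"


section \<open>Lightface pointclasses\<close>

type_synonym baire = "nat \<Rightarrow> nat"

text \<open>
  A space is presented by an enumeration \<open>N :: nat \<Rightarrow> 'a set\<close> of a basis. For Baire space these
  are the cylinders, indexed by the codes of finite sequences; for products they are the boxes.
\<close>

definition baire_nbhd :: "nat \<Rightarrow> baire set" where
  "baire_nbhd s = {x. \<forall>i < length (list_decode s). x i = list_decode s ! i}"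

definition prod_nbhd :: "(nat \<Rightarrow> 'a set) \<Rightarrow> (nat \<Rightarrow> 'b set) \<Rightarrow> nat \<Rightarrow> ('a \<times> 'b) set" where
  "prod_nbhd M N s = M (fst (prod_decode s)) \<times> N (snd (prod_decode s))"

definition Sigma01 :: "(nat \<Rightarrow> 'a set) \<Rightarrow> 'a set \<Rightarrow> bool" where
  "Sigma01 N A \<longleftrightarrow> (\<exists>W. rec_enumerable W \<and> A = (\<Union>s\<in>W. N s))"

definition Pi01 :: "(nat \<Rightarrow> 'a set) \<Rightarrow> 'a set \<Rightarrow> bool" where
  "Pi01 N A \<longleftrightarrow> Sigma01 N (- A)"

definition Sigma11 :: "(nat \<Rightarrow> 'a set) \<Rightarrow> 'a set \<Rightarrow> bool" where
  "Sigma11 N A \<longleftrightarrow> (\<exists>C. Pi01 (prod_nbhd N baire_nbhd) C \<and> A = {x. \<exists>z. (x, z) \<in> C})"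

definition Pi11 :: "(nat \<Rightarrow> 'a set) \<Rightarrow> 'a set \<Rightarrow> bool" where
  "Pi11 N A \<longleftrightarrow> Sigma11 N (- A)"

definition Delta11 :: "(nat \<Rightarrow> 'a set) \<Rightarrow> 'a set \<Rightarrow> bool" where
  "Delta11 N A \<longleftrightarrow> Sigma11 N A \<and> Pi11 N A"

definition Hyp_function :: "(baire \<Rightarrow> baire) \<Rightarrow> bool" where
  "Hyp_function F \<longleftrightarrow> Delta11 (prod_nbhd baire_nbhd baire_nbhd) {(x, y). y = F x}"

end

theory Submission
  imports Defs
begin

text \<open>
  A \<open>\<Sigma>\<^sup>1\<^sub>1\<close> pair \<open>P, Q\<close> can be enlarged to a \<open>\<Sigma>\<^sup>1\<^sub>1\<close> pair \<open>P', Q'\<close> which covers everything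
  while \<open>P' \<inter> Q' = P \<inter> Q\<close> (the dual of \<open>\<Pi>\<^sup>1\<^sub>1\<close> reduction): compare the trees of attempted witnesses
  in a game in which one player climbs the tree of \<open>P\<close>, the other answers in the tree of \<open>Q\<close>, and a player
  who cannot move loses. \<open>P'\<close> and \<open>Q'\<close> say that the respective player has a strategy that never loses.

  ``No Hyp function maps \<open>A\<close> into \<open>B\<close>'' is implied by a \<open>\<Sigma>\<^sup>1\<^sub>1\<close> condition \<open>R(A, B)\<close> on the indices
  of the \<open>\<Pi>\<^sup>0\<^sub>1\<close> sets \<open>A, B\<close>, and \<open>R(A, B)\<close> holds if \<open>A \<noteq> {} = B\<close>. Apply the enlargement
  to \<open>R(A, B)\<close> and \<open>R(B, A)\<close>, obtaining \<open>U\<close> and \<open>V\<close>. By a diagonal choice of the indices, \<open>A\<close> is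
  nonempty iff \<open>V\<close> holds of them, and \<open>B\<close> is nonempty iff \<open>U\<close> does. One of the sets is nonempty because
  \<open>U\<close> and \<open>V\<close> cover everything. If \<open>B\<close> were the only empty one, then \<open>R(A, B)\<close>, hence \<open>U\<close>, and
  \<open>B \<noteq> {}\<close>; symmetrically for \<open>A\<close>. So both are nonempty, \<open>U\<close> and \<open>V\<close> hold, and therefore \<open>R(A, B)\<close> and
  \<open>R(B, A)\<close>.
\<close>

section \<open>Recursive functions\<close>

abbreviation pr :: "nat \<Rightarrow> nat \<Rightarrow> nat" where "pr a b \<equiv> prod_encode (a, b)"
abbreviation p1 :: "nat \<Rightarrow> nat" where "p1 n \<equiv> fst (prod_decode n)"
abbreviation p2 :: "nat \<Rightarrow> nat" where "p2 n \<equiv> snd (prod_decode n)"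

text \<open>The rules of \<open>recursive_fn\<close> also produce definite values on lists of the
  wrong length, so that class is not invariant under changing a function there. \<open>recf\<close>
  closes it under such changes.\<close>

definition recf :: "nat \<Rightarrow> (nat list \<Rightarrow> nat) \<Rightarrow> bool" where
  "recf k f \<longleftrightarrow> (\<exists>f'. recursive_fn k f' \<and> (\<forall>xs. length xs = k \<longrightarrow> f' xs = f xs))"

lemma recf_cong: "recf k f \<Longrightarrow> (\<And>xs. length xs = k \<Longrightarrow> f xs = g xs) \<Longrightarrow> recf k g"
  unfolding recf_def by metis

lemma recf_comp:
  assumes "recf (length gs) f" "\<forall>g\<in>set gs. recf k g"
  shows "recf k (\<lambda>xs. f (map (\<lambda>g. g xs) gs))"
proof -
  obtain f' where f': "recursive_fn (length gs) f'" "\<forall>xs. length xs = length gs \<longrightarrow> f' xs = f xs"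
    using assms(1) unfolding recf_def by blast
  have "\<forall>g\<in>set gs. \<exists>g'. recursive_fn k g' \<and> (\<forall>xs. length xs = k \<longrightarrow> g' xs = g xs)"
    using assms(2) unfolding recf_def by blast
  then obtain H where H: "\<forall>g\<in>set gs. recursive_fn k (H g) \<and> (\<forall>xs. length xs = k \<longrightarrow> H g xs = g xs)"
    by metis
  have "recursive_fn k (\<lambda>xs. f' (map (\<lambda>g. g xs) (map H gs)))"
    by (rule recursive_fn.comp) (use f' H in auto)
  moreover have "f' (map (\<lambda>g. g xs) (map H gs)) = f (map (\<lambda>g. g xs) gs)" if "length xs = k" for xs
  proof -
    have "map (\<lambda>g. g xs) (map H gs) = map (\<lambda>g. g xs) gs" using H that by simp
    moreover have "length (map (\<lambda>g. g xs) gs) = length gs" by simp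
    ultimately show ?thesis using f'(2) by metis
  qed
  ultimately show ?thesis unfolding recf_def by blast
qed

lemma recf_proj: "i < k \<Longrightarrow> recf k (\<lambda>xs. xs ! i)"
  unfolding recf_def using recursive_fn.proj by blast

definition rec1 :: "(nat \<Rightarrow> nat) \<Rightarrow> bool" where
  "rec1 f \<longleftrightarrow> recf 1 (\<lambda>xs. f (xs ! 0))"
definition rec2 :: "(nat \<Rightarrow> nat \<Rightarrow> nat) \<Rightarrow> bool" where
  "rec2 f \<longleftrightarrow> recf 2 (\<lambda>xs. f (xs ! 0) (xs ! 1))"
definition rec3 :: "(nat \<Rightarrow> nat \<Rightarrow> nat \<Rightarrow> nat) \<Rightarrow> bool" where
  "rec3 f \<longleftrightarrow> recf 3 (\<lambda>xs. f (xs ! 0) (xs ! 1) (xs ! 2))"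

lemma rec1_cong: "rec1 f \<Longrightarrow> (\<And>a. f a = g a) \<Longrightarrow> rec1 g"
  by (erule back_subst[of rec1]) (intro ext, simp)

lemma rec2_cong: "rec2 f \<Longrightarrow> (\<And>a b. f a b = g a b) \<Longrightarrow> rec2 g"
  by (erule back_subst[of rec2]) (intro ext, simp)

lemma recf_1: "rec1 f \<Longrightarrow> recf k g \<Longrightarrow> recf k (\<lambda>xs. f (g xs))"
  using recf_comp[of "[g]" "\<lambda>xs. f (xs ! 0)" k] by (simp add: rec1_def)

lemma recf_2: "rec2 f \<Longrightarrow> recf k g \<Longrightarrow> recf k h \<Longrightarrow> recf k (\<lambda>xs. f (g xs) (h xs))"
  using recf_comp[of "[g, h]" "\<lambda>xs. f (xs ! 0) (xs ! 1)" k]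
  by (simp add: rec2_def numeral_2_eq_2)

lemma recf_3:
  "rec3 f \<Longrightarrow> recf k g \<Longrightarrow> recf k h \<Longrightarrow> recf k l \<Longrightarrow> recf k (\<lambda>xs. f (g xs) (h xs) (l xs))"
  using recf_comp[of "[g, h, l]" "\<lambda>xs. f (xs ! 0) (xs ! 1) (xs ! 2)" k]
  by (simp add: rec3_def numeral_2_eq_2 numeral_3_eq_3)

lemma rec1_Suc: "rec1 Suc"
  unfolding rec1_def recf_def using recursive_fn.succ by blast

lemma recf_const: "recf k (\<lambda>xs. c)"
proof (induction c)
  case 0
  then show ?case unfolding recf_def using recursive_fn.zero by blast
next
  case (Suc c)
  then show ?case using recf_1[OF rec1_Suc] by blast
qed

lemma recf_prim_rec:
  assumes "recf k f" "recf (Suc (Suc k)) g" "recf k h"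
  shows "recf k (\<lambda>xs. rec_nat (f xs) (\<lambda>n r. g (n # r # xs)) (h xs))"
proof -
  obtain f' where f': "recursive_fn k f'" "\<forall>xs. length xs = k \<longrightarrow> f' xs = f xs"
    using assms(1) unfolding recf_def by blast
  obtain g' where g': "recursive_fn (Suc (Suc k)) g'" "\<forall>xs. length xs = Suc (Suc k) \<longrightarrow> g' xs = g xs"
    using assms(2) unfolding recf_def by blast
  let ?R = "\<lambda>xs. rec_nat (f (tl xs)) (\<lambda>n r. g (n # r # tl xs)) (hd xs)"
  have "recf (Suc k) ?R"
    unfolding recf_def
    by (rule exI, rule conjI, rule recursive_fn.prim_rec[OF f'(1) g'(1)]) (use f' g' in simp)
  then have R: "recf (length (h # map (\<lambda>i xs. xs ! i) [0..<k])) ?R" by simp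
  have "recf k (\<lambda>xs. ?R (map (\<lambda>g. g xs) (h # map (\<lambda>i xs. xs ! i) [0..<k])))"
    by (rule recf_comp[OF R]) (use assms(3) recf_proj in auto)
  then show ?thesis
  proof (rule recf_cong)
    fix xs :: "nat list" assume "length xs = k"
    then have "map (\<lambda>i. xs ! i) [0..<k] = xs" using map_nth by blast
    then show "?R (map (\<lambda>g. g xs) (h # map (\<lambda>i xs. xs ! i) [0..<k])) =
        rec_nat (f xs) (\<lambda>n r. g (n # r # xs)) (h xs)"
      by (simp add: comp_def)
  qed
qed

lemma recf_Least:
  assumes "recf (Suc k) g" "\<And>xs. length xs = k \<Longrightarrow> \<exists>m. g (m # xs) = 0"
  shows "recf k (\<lambda>xs. LEAST m. g (m # xs) = 0)"
proof -
  obtain g' where g': "recursive_fn (Suc k) g'" "\<forall>xs. length xs = Suc k \<longrightarrow> g' xs = g xs"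
    using assms(1) unfolding recf_def by blast
  have "recursive_fn k (\<lambda>xs. LEAST m. g' (m # xs) = 0)"
    by (rule recursive_fn.minimalization[OF g'(1)]) (use g' assms(2) in simp)
  then show ?thesis unfolding recf_def using g'(2) by auto
qed

lemma rec2_prim_rec:
  assumes "rec1 f" "rec3 g"
  shows "rec2 (\<lambda>n a. rec_nat (f a) (\<lambda>m r. g m r a) n)"
proof -
  have "recf 2 (\<lambda>xs. rec_nat (f (xs ! 1)) (\<lambda>n r. (\<lambda>ys. g (ys ! 0) (ys ! 1) (ys ! 3)) (n # r # xs)) (xs ! 0))"
    by (intro recf_prim_rec recf_1[OF assms(1)] recf_3[OF assms(2)] recf_proj) auto
  then show ?thesis by (simp add: rec2_def numeral_3_eq_3)
qed

section \<open>Arithmetic, definition by cases and pairing\<close>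

lemma rec1_id: "rec1 (\<lambda>x. x)"
  by (simp add: rec1_def recf_proj)

lemmas recf_basic = recf_proj recf_const recf_1[OF rec1_Suc]

lemma rec2_add: "rec2 (+)"
proof -
  have "rec3 (\<lambda>m r a. Suc r)" unfolding rec3_def by (intro recf_basic) simp
  from rec2_prim_rec[OF rec1_id this] have "rec2 (\<lambda>n a. rec_nat a (\<lambda>m. Suc) n)" .
  moreover have "rec_nat a (\<lambda>m. Suc) n = n + a" for n a by (induction n) auto
  ultimately show ?thesis by simp
qed

lemma rec1_prim_rec:
  assumes "rec2 g"
  shows "rec1 (\<lambda>n. rec_nat c (\<lambda>m r. g m r) n)"
proof -
  have "recf 1 (\<lambda>xs. rec_nat c (\<lambda>n r. (\<lambda>ys. g (ys ! 0) (ys ! 1)) (n # r # xs)) (xs ! 0))"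
    by (intro recf_prim_rec recf_2[OF assms(1)] recf_basic) auto
  then show ?thesis by (simp add: rec1_def)
qed

lemma rec1_pred: "rec1 (\<lambda>n. n - 1)"
proof -
  have "rec2 (\<lambda>m r. m)" unfolding rec2_def by (intro recf_basic) simp
  from rec1_prim_rec[OF this, of 0] show ?thesis
    by (rule rec1_cong) (case_tac a, auto)
qed

lemma rec2_swap: "rec2 f \<Longrightarrow> rec2 (\<lambda>a b. f b a)"
  by (subst rec2_def, rule recf_2) (auto intro: recf_basic)

lemma rec2_diff: "rec2 (-)"
proof -
  have "rec3 (\<lambda>m r a. r - 1)" unfolding rec3_def by (intro recf_1[OF rec1_pred] recf_basic) simp
  from rec2_prim_rec[OF rec1_id this] have "rec2 (\<lambda>n a. rec_nat a (\<lambda>m r. r - 1) n)" .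
  moreover have "rec_nat a (\<lambda>m r. r - 1) n = a - n" for n a by (induction n) auto
  ultimately show ?thesis using rec2_swap[of "\<lambda>n a. a - n"] by simp
qed

lemma rec3_if: "rec3 (\<lambda>c a b. if c = 0 then a else b)"
proof -
  \<comment> \<open>Recursion on the condition without use of the previous value;
    \<open>ys ! 4\<close> is the else-branch, displaced by the two arguments put in front of
    \<open>xs\<close>.\<close>
  have "recf 3 (\<lambda>xs. rec_nat (xs ! 1) (\<lambda>n r. (\<lambda>ys. ys ! 4) (n # r # xs)) (xs ! 0))"
    by (intro recf_prim_rec recf_basic) auto
  moreover have "rec_nat a (\<lambda>n r. b) c = (if c = 0 then a else b)" for a b c :: nat
    by (cases c) auto
  ultimately show ?thesis by (simp add: rec3_def)
qed

lemma rec1_triangle: "rec1 triangle"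
proof -
  have "rec2 (\<lambda>m r. r + Suc m)" unfolding rec2_def by (intro recf_2[OF rec2_add] recf_basic) auto
  from rec1_prim_rec[OF this, of 0] have "rec1 (rec_nat 0 (\<lambda>m r. r + Suc m))" .
  moreover have "rec_nat 0 (\<lambda>m r. r + Suc m) n = triangle n" for n by (induction n) auto
  ultimately show ?thesis by (rule rec1_cong)
qed

lemma rec2_pr: "rec2 pr"
  unfolding rec2_def prod_encode_def
  by (simp, intro recf_2[OF rec2_add] recf_1[OF rec1_triangle] recf_basic) auto

lemma triangle_mono: "m \<le> n \<Longrightarrow> triangle m \<le> triangle n"
  by (induction n) (auto simp: le_Suc_eq)

text \<open>Since \<open>pr a b\<close> is \<open>triangle (a + b) + a\<close>, the diagonal a + b
  is the least m with n < \<open>triangle (Suc m)\<close>. Written as a vanishing truncated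
  difference, this is ready for minimalization.\<close>

lemma p1_p2_Least:
  defines "d \<equiv> \<lambda>n. LEAST m. Suc n - triangle (Suc m) = 0"
  shows "p1 n = n - triangle (d n)" "p2 n = d n - p1 n"
proof -
  obtain a b where n: "n = pr a b" by (metis prod.collapse prod_decode_inverse)
  have "d n = a + b"
    unfolding d_def
  proof (rule Least_equality)
    show "Suc n - triangle (Suc (a + b)) = 0" by (simp add: n prod_encode_def)
  next
    fix m assume m: "Suc n - triangle (Suc m) = 0"
    show "a + b \<le> m"
    proof (rule ccontr)
      assume "\<not> a + b \<le> m"
      then have "triangle (Suc m) \<le> triangle (a + b)" by (intro triangle_mono) simp
      then show False using m by (simp add: n prod_encode_def)
    qed
  qed
  then show "p1 n = n - triangle (d n)" "p2 n = d n - p1 n"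
    by (simp_all add: n) (simp add: prod_encode_def)
qed

lemma rec1_p1: "rec1 p1" and rec1_p2: "rec1 p2"
proof -
  define d where "d \<equiv> \<lambda>n. LEAST m. Suc n - triangle (Suc m) = 0"
  have "recf 1 (\<lambda>xs. LEAST m. (\<lambda>ys. Suc (ys ! 1) - triangle (Suc (ys ! 0))) (m # xs) = 0)"
  proof (rule recf_Least)
    show "recf (Suc 1) (\<lambda>ys. Suc (ys ! 1) - triangle (Suc (ys ! 0)))"
      by (intro recf_2[OF rec2_diff] recf_1[OF rec1_triangle] recf_basic) auto
  next
    fix xs :: "nat list"
    have "n \<le> triangle n" for n by (induction n) auto
    from this[of "Suc (xs ! 0)"]
    show "\<exists>m. Suc ((m # xs) ! 1) - triangle (Suc ((m # xs) ! 0)) = 0"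
      by (intro exI[of _ "xs ! 0"]) simp
  qed
  then have d: "rec1 d" by (simp add: rec1_def d_def)
  have "rec1 (\<lambda>n. n - triangle (d n))"
    unfolding rec1_def
    by (intro recf_2[OF rec2_diff] recf_1[OF rec1_triangle] recf_1[OF d] recf_basic) auto
  then show 1: "rec1 p1" using p1_p2_Least(1) unfolding d_def by presburger
  have "rec1 (\<lambda>n. d n - p1 n)"
    unfolding rec1_def
    by (intro recf_2[OF rec2_diff] recf_1[OF 1] recf_1[OF d] recf_basic) auto
  then show "rec1 p2" using p1_p2_Least(2) unfolding d_def by presburger
qed

section \<open>Operations on codes of finite sequences\<close>

abbreviation lnth :: "nat \<Rightarrow> nat \<Rightarrow> nat" where
  "lnth s i \<equiv> (if i < length (list_decode s) then list_decode s ! i else 0)"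

text \<open>A nonempty list has code \<open>Suc (pr x s)\<close> with s the code of its tail, so one
  term is dropped by predecessor and \<open>p2\<close>, while the code 0 of the empty list stays
  fixed. This is iterated i times.\<close>

lemma rec2_drop: "rec2 (\<lambda>i s. list_encode (drop i (list_decode s)))"
proof -
  have "rec3 (\<lambda>m r a. if r = 0 then 0 else p2 (r - 1))"
    unfolding rec3_def by (intro recf_3[OF rec3_if] recf_1[OF rec1_p2] recf_1[OF rec1_pred] recf_basic) auto
  note rec2_prim_rec[OF rec1_id this]
  moreover have "rec_nat s (\<lambda>m r. if r = 0 then 0 else p2 (r - 1)) i = list_encode (drop i (list_decode s))" for i s
  proof (induction i)
    case (Suc i)
    have "(if list_encode ys = 0 then 0 else p2 (list_encode ys - 1)) = list_encode (tl ys)" for ys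
      by (cases ys) auto
    then show ?case using Suc by (simp add: drop_Suc drop_tl)
  qed simp
  ultimately show ?thesis by (rule rec2_cong)
qed

lemma list_encode_eq_0: "list_encode xs = 0 \<longleftrightarrow> xs = []"
  by (cases xs) auto

text \<open>The length is found by a search for the first i at which dropping i terms leaves the
  code 0.\<close>

lemma rec1_length: "rec1 (\<lambda>s. length (list_decode s))"
proof -
  have "recf 1 (\<lambda>xs. LEAST m. (\<lambda>ys. list_encode (drop (ys ! 0) (list_decode (ys ! 1)))) (m # xs) = 0)"
  proof (rule recf_Least)
    show "recf (Suc 1) (\<lambda>ys. list_encode (drop (ys ! 0) (list_decode (ys ! 1))))"
      by (intro recf_2[OF rec2_drop] recf_basic) auto
  qed (auto simp: list_encode_eq_0)
  moreover have "(LEAST m. length ys \<le> m) = length ys" for ys :: "nat list"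
    by (rule Least_equality) auto
  ultimately show ?thesis by (simp add: rec1_def list_encode_eq_0)
qed

lemma rec2_lnth: "rec2 lnth"
proof -
  have "rec2 (\<lambda>s i. (\<lambda>r. if r = 0 then 0 else p1 (r - 1)) (list_encode (drop i (list_decode s))))"
    unfolding rec2_def
    by (intro recf_3[OF rec3_if] recf_1[OF rec1_p1] recf_1[OF rec1_pred] recf_2[OF rec2_drop] recf_basic) auto
  moreover have "(\<lambda>r. if r = 0 then 0 else p1 (r - 1)) (list_encode (drop i xs)) =
      (if i < length xs then xs ! i else 0)" for i and xs :: "nat list"
    by (cases "i < length xs") (auto simp: list_encode_eq_0 Cons_nth_drop_Suc[symmetric])
  ultimately show ?thesis by (rule rec2_cong)
qed

section \<open>Recursive functionals of sequences of reals\<close>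

type_synonym env = "nat \<Rightarrow> baire"

abbreviation push :: "baire \<Rightarrow> env \<Rightarrow> env" (infixr "##" 65) where
  "z ## X \<equiv> case_nat z X"
abbreviation num :: "nat \<Rightarrow> baire" where "num n \<equiv> \<lambda>_. n"

text \<open>Numerical parameters of a functional are passed as constant sequences \<open>num n\<close>, and \<open>##\<close> shifts the
  de Bruijn index of all other arguments.\<close>

inductive cf :: "(env \<Rightarrow> nat) \<Rightarrow> bool" where
  app: "cf h \<Longrightarrow> cf (\<lambda>X. X i (h X))"
| rec: "recf (length gs) f \<Longrightarrow> \<forall>g\<in>set gs. cf g \<Longrightarrow> cf (\<lambda>X. f (map (\<lambda>g. g X) gs))"

lemma cf_cong: "cf f \<Longrightarrow> (\<And>X. f X = g X) \<Longrightarrow> cf g"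
  by (erule back_subst[of cf]) (intro ext, simp)

lemma cf_const: "cf (\<lambda>X. c)"
  using cf.rec[of "[]" "\<lambda>_. c"] by (simp add: recf_const)

lemma cf_1: "rec1 f \<Longrightarrow> cf g \<Longrightarrow> cf (\<lambda>X. f (g X))"
  using cf.rec[of "[g]" "\<lambda>xs. f (xs ! 0)"] by (simp add: rec1_def)

lemma cf_2: "rec2 f \<Longrightarrow> cf g \<Longrightarrow> cf h \<Longrightarrow> cf (\<lambda>X. f (g X) (h X))"
  using cf.rec[of "[g, h]" "\<lambda>xs. f (xs ! 0) (xs ! 1)"] by (simp add: rec2_def numeral_2_eq_2)

lemma cf_3: "rec3 f \<Longrightarrow> cf g \<Longrightarrow> cf h \<Longrightarrow> cf l \<Longrightarrow> cf (\<lambda>X. f (g X) (h X) (l X))"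
  using cf.rec[of "[g, h, l]" "\<lambda>xs. f (xs ! 0) (xs ! 1) (xs ! 2)"]
  by (simp add: rec3_def numeral_2_eq_2 numeral_3_eq_3)

section \<open>Decidable predicates of an environment\<close>

definition dec :: "(env \<Rightarrow> bool) \<Rightarrow> bool" where
  "dec P \<longleftrightarrow> cf (\<lambda>X. if P X then 0 else 1)"

lemma dec_cong: "dec P \<Longrightarrow> (\<And>X. P X \<longleftrightarrow> Q X) \<Longrightarrow> dec Q"
  by (erule back_subst[of dec]) (intro ext, simp)

lemma cf_if: "dec P \<Longrightarrow> cf f \<Longrightarrow> cf g \<Longrightarrow> cf (\<lambda>X. if P X then f X else g X)"
  unfolding dec_def
  by (rule cf_cong[OF cf_3[OF rec3_if, of "\<lambda>X. if P X then 0 else 1" f g]]) auto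

lemma dec_0: "cf f \<Longrightarrow> dec (\<lambda>X. f X = 0)"
  using cf_3[OF rec3_if, of f "\<lambda>_. 0" "\<lambda>_. 1"] by (simp add: dec_def cf_const)

lemma dec_not: "dec P \<Longrightarrow> dec (\<lambda>X. \<not> P X)"
  by (rule dec_cong[OF dec_0[OF cf_if[of P "\<lambda>_. 1" "\<lambda>_. 0"]]]) (auto simp: cf_const)

lemma dec_if: "dec P \<Longrightarrow> dec Q \<Longrightarrow> dec R \<Longrightarrow> dec (\<lambda>X. if P X then Q X else R X)"
  unfolding dec_def[of Q] dec_def[of R] dec_def[of "\<lambda>X. if P X then Q X else R X"]
  by (rule cf_cong[OF cf_if[of P "\<lambda>X. if Q X then 0 else 1" "\<lambda>X. if R X then 0 else 1"]]) auto

lemma dec_True: "dec (\<lambda>X. True)" and dec_False: "dec (\<lambda>X. False)"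
  by (simp_all add: dec_def cf_const)

lemma dec_and: "dec P \<Longrightarrow> dec Q \<Longrightarrow> dec (\<lambda>X. P X \<and> Q X)"
  by (rule dec_cong[OF dec_if[of P Q "\<lambda>_. False"]]) (auto simp: dec_False)

lemma dec_or: "dec P \<Longrightarrow> dec Q \<Longrightarrow> dec (\<lambda>X. P X \<or> Q X)"
  by (rule dec_cong[OF dec_if[of P "\<lambda>_. True" Q]]) (auto simp: dec_True)

lemma dec_imp: "dec P \<Longrightarrow> dec Q \<Longrightarrow> dec (\<lambda>X. P X \<longrightarrow> Q X)"
  by (rule dec_cong[OF dec_if[of P Q "\<lambda>_. True"]]) (auto simp: dec_True)

lemma dec_le: "cf f \<Longrightarrow> cf g \<Longrightarrow> dec (\<lambda>X. f X \<le> g X)"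
  using dec_0[OF cf_2[OF rec2_diff, of f g]] by simp

lemma dec_less: "cf f \<Longrightarrow> cf g \<Longrightarrow> dec (\<lambda>X. f X < g X)"
  using dec_not[OF dec_le[of g f]] by (simp add: not_le)

lemma dec_eq: "cf f \<Longrightarrow> cf g \<Longrightarrow> dec (\<lambda>X. f X = g X)"
  using dec_and[OF dec_le[of f g] dec_le[of g f]] by (simp add: order_eq_iff)

lemmas cf_intros = cf_const cf_1[OF rec1_Suc] cf_2[OF rec2_pr] cf_1[OF rec1_p1] cf_1[OF rec1_p2]
  cf_1[OF rec1_length] cf_2[OF rec2_lnth] cf_2[OF rec2_diff] cf_2[OF rec2_add]
  dec_not dec_and dec_or dec_imp dec_le dec_less dec_eq dec_True dec_False dec_if cf_if cf.app

section \<open>Substitution into functionals\<close>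

lemma cf_subst:
  assumes "cf \<Phi>" "\<And>i h. cf h \<Longrightarrow> cf (\<lambda>X. \<sigma> X i (h X))"
  shows "cf (\<lambda>X. \<Phi> (\<sigma> X))"
  using assms(1)
proof induction
  case (app h i)
  then show ?case using assms(2) by blast
next
  case (rec gs f)
  then show ?case using cf.rec[of "map (\<lambda>g X. g (\<sigma> X)) gs" f] by (simp add: comp_def)
qed

lemma cf_shift: "cf \<Phi> \<Longrightarrow> cf (\<lambda>X. \<Phi> (\<lambda>i. X (g i)))"
  by (erule cf_subst) (rule cf.app)

text \<open>Computability must be uniform in the position at which a substituted sequence is
  queried. That position is passed as index 0, and the substitution sees the environment shifted by
  one.\<close>

definition sub :: "(env \<Rightarrow> env) \<Rightarrow> bool" where
  "sub \<sigma> \<longleftrightarrow> (\<forall>i. cf (\<lambda>X. \<sigma> (\<lambda>j. X (Suc j)) i (X 0 0)))"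

lemma sub_cf:
  assumes "sub \<sigma>" "cf h"
  shows "cf (\<lambda>X. \<sigma> (\<lambda>j. X (g j)) i (h X))"
proof -
  have "cf (\<lambda>X. \<sigma> (\<lambda>j. (num (h X) ## (\<lambda>j. X (g j))) (Suc j)) i ((num (h X) ## (\<lambda>j. X (g j))) 0 0))"
  proof (rule cf_subst[of "\<lambda>X. \<sigma> (\<lambda>j. X (Suc j)) i (X 0 0)"])
    show "cf (\<lambda>X. \<sigma> (\<lambda>j. X (Suc j)) i (X 0 0))" using assms(1) by (simp add: sub_def)
    show "cf (\<lambda>X. (num (h X) ## (\<lambda>j. X (g j))) k (l X))" if "cf l" for k l
      using assms(2) cf.app[OF that] by (cases k) simp_all
  qed
  then show ?thesis by simp
qed

lemma sub_push:
  "cf (\<lambda>X. a (\<lambda>j. X (Suc j)) (X 0 0)) \<Longrightarrow> sub \<sigma> \<Longrightarrow> sub (\<lambda>X. a X ## \<sigma> X)"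
  unfolding sub_def by (intro allI, case_tac i) auto

lemma sub_shift: "sub (\<lambda>X i. X (g i))"
  unfolding sub_def by (intro allI cf_intros)

lemma sub_num: "sub (\<lambda>X i. num (u i))"
  by (auto simp: sub_def intro: cf_intros)

lemmas sub_intros = sub_push sub_shift sub_shift[where g="\<lambda>i. i"] sub_num

lemma cf_sub: "cf \<Phi> \<Longrightarrow> sub \<sigma> \<Longrightarrow> cf (\<lambda>X. \<Phi> (\<sigma> X))"
  using cf_subst[of \<Phi> \<sigma>] sub_cf[of \<sigma> _ "\<lambda>i. i"] by simp

lemma dec_sub: "dec P \<Longrightarrow> sub \<sigma> \<Longrightarrow> dec (\<lambda>X. P (\<sigma> X))"
  unfolding dec_def by (rule cf_sub[of "\<lambda>X. if P X then 0 else 1"])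

text \<open>Lifts a substitution under the two binders of \<open>sig\<close>, the witness and the
  number, which are left alone.\<close>

lemma sub_push2:
  assumes "sub \<sigma>" shows "sub (\<lambda>X. X 0 ## X 1 ## \<sigma> (\<lambda>i. X (i + 2)))"
proof -
  have "cf (\<lambda>X. \<sigma> (\<lambda>j. X (j + 3)) i (X 0 0))" for i
    using sub_cf[OF assms, of "\<lambda>X. X 0 0" "\<lambda>j. j + 3" i] by (simp add: cf.app cf_const)
  then have "sub (\<lambda>X. \<sigma> (\<lambda>i. X (i + 2)))" by (simp add: sub_def numeral_3_eq_3)
  then show ?thesis by (intro sub_push cf.app cf_const)
qed

section \<open>Lightface \<open>\<Pi>\<^sup>0\<^sub>1\<close> and \<open>\<Sigma>\<^sup>1\<^sub>1\<close> predicates\<close>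

definition pi :: "(env \<Rightarrow> bool) \<Rightarrow> bool" where
  "pi P \<longleftrightarrow> (\<exists>D. dec D \<and> (\<forall>X. P X \<longleftrightarrow> (\<forall>n. D (num n ## X))))"

definition sig :: "(env \<Rightarrow> bool) \<Rightarrow> bool" where
  "sig P \<longleftrightarrow> (\<exists>D. dec D \<and> (\<forall>X. P X \<longleftrightarrow> (\<exists>z. \<forall>n. D (z ## num n ## X))))"

lemma pi_sig:
  assumes "pi P" shows "sig P"
proof -
  obtain D where D: "dec D" "\<And>X. P X \<longleftrightarrow> (\<forall>n. D (num n ## X))"
    using assms unfolding pi_def by blast
  have "dec (\<lambda>X. D (\<lambda>i. X (Suc i)))" using D(1) unfolding dec_def by (rule cf_shift)
  then show ?thesis unfolding sig_def using D(2) by (intro exI[of _ "\<lambda>X. D (\<lambda>i. X (Suc i))"]) simp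
qed

lemma pi_dec: "dec P \<Longrightarrow> pi P"
  unfolding pi_def dec_def using cf_shift[of "\<lambda>X. if P X then 0 else 1" Suc]
  by (intro exI[of _ "\<lambda>X. P (\<lambda>i. X (Suc i))"]) simp

lemmas sig_dec = pi_dec[THEN pi_sig]

lemma pi_all:
  assumes "pi (\<lambda>X. B (\<lambda>i. X (Suc i)) (X 0 0))"
  shows "pi (\<lambda>X. \<forall>n. B X n)"
proof -
  obtain D where D: "dec D" "\<And>X. B (\<lambda>i. X (Suc i)) (X 0 0) \<longleftrightarrow> (\<forall>n. D (num n ## X))"
    using assms unfolding pi_def by blast
  let ?D = "\<lambda>X. D (num (p1 (X 0 0)) ## num (p2 (X 0 0)) ## (\<lambda>i. X (Suc i)))"
  have "dec ?D"
    by (intro dec_sub[OF D(1)] sub_intros cf_intros)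
  moreover have "(\<forall>n. B X n) \<longleftrightarrow> (\<forall>n. ?D (num n ## X))" for X
  proof -
    have "(\<forall>n. B X n) \<longleftrightarrow> (\<forall>n m. D (num m ## num n ## X))"
      using D(2)[of "num _ ## X"] by simp
    then show ?thesis by simp (metis fst_conv snd_conv prod_encode_inverse)
  qed
  ultimately show ?thesis unfolding pi_def by blast
qed

lemma pi_conj:
  assumes "pi P" "pi Q" shows "pi (\<lambda>X. P X \<and> Q X)"
proof -
  obtain D where D: "dec D" "\<And>X. P X \<longleftrightarrow> (\<forall>n. D (num n ## X))"
    using assms unfolding pi_def by blast
  obtain E where E: "dec E" "\<And>X. Q X \<longleftrightarrow> (\<forall>n. E (num n ## X))"
    using assms unfolding pi_def by blast
  show ?thesis unfolding pi_def
    by (intro exI[of _ "\<lambda>X. D X \<and> E X"]) (use D E dec_and in auto)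
qed

lemma sig_ex:
  assumes "sig (\<lambda>X. B (\<lambda>i. X (Suc i)) (X 0))"
  shows "sig (\<lambda>X. \<exists>y. B X y)"
proof -
  obtain D where D: "dec D" "\<And>X. B (\<lambda>i. X (Suc i)) (X 0) \<longleftrightarrow> (\<exists>z. \<forall>n. D (z ## num n ## X))"
    using assms unfolding sig_def by blast
  let ?D = "\<lambda>X. D ((\<lambda>t. X 0 (pr 0 t)) ## X 1 ## (\<lambda>t. X 0 (pr 1 t)) ## (\<lambda>i. X (i + 2)))"
  have "dec ?D"
    by (intro dec_sub[OF D(1)] sub_intros cf_intros)
  moreover have "(\<exists>y. B X y) \<longleftrightarrow> (\<exists>z. \<forall>n. ?D (z ## num n ## X))" for X
  proof -
    have "B X y \<longleftrightarrow> (\<exists>z. \<forall>n. D (z ## num n ## y ## X))" for y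
      using D(2)[of "y ## X"] by simp
    then have "(\<exists>y. B X y) \<longleftrightarrow> (\<exists>z y. \<forall>n. D (z ## num n ## y ## X))" by blast
    also have "\<dots> \<longleftrightarrow> (\<exists>w. \<forall>n. D ((\<lambda>t. w (pr 0 t)) ## num n ## (\<lambda>t. w (pr 1 t)) ## X))"
    proof (intro iffI; elim exE)
      fix z y assume *: "\<forall>n. D (z ## num n ## y ## X)"
      show "\<exists>w. \<forall>n. D ((\<lambda>t. w (pr 0 t)) ## num n ## (\<lambda>t. w (pr 1 t)) ## X)"
        by (rule exI[of _ "\<lambda>p. if p1 p = 0 then z (p2 p) else y (p2 p)"]) (use * in simp)
    qed blast
    finally show ?thesis by simp
  qed
  ultimately show ?thesis unfolding sig_def by blast
qed

lemma sig_sub: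
  assumes "sig P" "sub \<sigma>" shows "sig (\<lambda>X. P (\<sigma> X))"
proof -
  obtain D where D: "dec D" "\<And>X. P X \<longleftrightarrow> (\<exists>z. \<forall>n. D (z ## num n ## X))"
    using assms unfolding sig_def by blast
  let ?D = "\<lambda>X. D (X 0 ## X 1 ## \<sigma> (\<lambda>i. X (i + 2)))"
  have "dec ?D" by (rule dec_sub[OF D(1) sub_push2[OF assms(2)]])
  moreover have "P (\<sigma> X) \<longleftrightarrow> (\<exists>z. \<forall>n. ?D (z ## num n ## X))" for X
    using D(2) by simp
  ultimately show ?thesis unfolding sig_def by blast
qed

lemma sig_exn:
  assumes "sig (\<lambda>X. B (\<lambda>i. X (Suc i)) (X 0 0))"
  shows "sig (\<lambda>X. \<exists>n. B X n)"
proof -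
  have "sig (\<lambda>X. \<exists>y::baire. B X (y 0))" by (rule sig_ex[of "\<lambda>X y. B X (y 0)"]) (rule assms)
  moreover have "(\<exists>y::baire. B X (y 0)) \<longleftrightarrow> (\<exists>n. B X n)" for X
    using exI[of "\<lambda>y::baire. B X (y 0)" "num _"] by blast
  ultimately show ?thesis by simp
qed

text \<open>Countable choice picks a witness \<open>Z m\<close> for every m. All of them are stored
  as sections of a single real, and the two number quantifiers are merged by pairing.\<close>

lemma sig_all:
  assumes "sig (\<lambda>X. B (\<lambda>i. X (Suc i)) (X 0 0))"
  shows "sig (\<lambda>X. \<forall>n. B X n)"
proof -
  obtain D where D: "dec D" "\<And>X. B (\<lambda>i. X (Suc i)) (X 0 0) \<longleftrightarrow> (\<exists>z. \<forall>n. D (z ## num n ## X))"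
    using assms unfolding sig_def by blast
  let ?D = "\<lambda>X. D ((\<lambda>t. X 0 (pr (p1 (X 1 0)) t)) ## num (p2 (X 1 0)) ## num (p1 (X 1 0)) ## (\<lambda>i. X (i + 2)))"
  have "dec ?D"
    by (intro dec_sub[OF D(1)] sub_intros cf_intros)
  moreover have "(\<forall>m. B X m) \<longleftrightarrow> (\<exists>z. \<forall>n. ?D (z ## num n ## X))" for X
  proof -
    have "B X m \<longleftrightarrow> (\<exists>z. \<forall>n. D (z ## num n ## num m ## X))" for m
      using D(2)[of "num m ## X"] by simp
    then have "(\<forall>m. B X m) \<longleftrightarrow> (\<exists>Z. \<forall>m n. D (Z m ## num n ## num m ## X))" by metis
    also have "\<dots> \<longleftrightarrow> (\<exists>w. \<forall>m n. D ((\<lambda>t. w (pr m t)) ## num n ## num m ## X))"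
    proof (intro iffI; elim exE)
      fix Z assume *: "\<forall>m n. D (Z m ## num n ## num m ## X)"
      show "\<exists>w. \<forall>m n. D ((\<lambda>t. w (pr m t)) ## num n ## num m ## X)"
        by (rule exI[of _ "\<lambda>p. Z (p1 p) (p2 p)"]) (use * in simp)
    next
      fix w assume "\<forall>m n. D ((\<lambda>t. w (pr m t)) ## num n ## num m ## X)"
      then show "\<exists>Z. \<forall>m n. D (Z m ## num n ## num m ## X)" by (rule exI[of _ "\<lambda>m t. w (pr m t)"])
    qed
    also have "\<dots> \<longleftrightarrow> (\<exists>w. \<forall>n. D ((\<lambda>t. w (pr (p1 n) t)) ## num (p2 n) ## num (p1 n) ## X))"
      by (metis fst_conv snd_conv prod_encode_inverse)
    finally show ?thesis by simp
  qed
  ultimately show ?thesis unfolding sig_def by blast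
qed

lemma sig_if:
  assumes "dec C" "sig P" "sig Q" shows "sig (\<lambda>X. if C X then P X else Q X)"
proof -
  obtain D where D: "dec D" "\<And>X. P X \<longleftrightarrow> (\<exists>z. \<forall>n. D (z ## num n ## X))"
    using assms unfolding sig_def by blast
  obtain E where E: "dec E" "\<And>X. Q X \<longleftrightarrow> (\<exists>z. \<forall>n. E (z ## num n ## X))"
    using assms unfolding sig_def by blast
  have "dec (\<lambda>X. C (\<lambda>i. X (i + 2)))" using assms(1) unfolding dec_def by (rule cf_shift)
  from dec_if[OF this D(1) E(1)] show ?thesis unfolding sig_def
    by (intro exI[of _ "\<lambda>X. if C (\<lambda>i. X (i + 2)) then D X else E X"] conjI) (simp_all add: D E)
qed

text \<open>A conjunction is a universal number quantifier over two branches, so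
  \<open>sig_all\<close> does the merging of the witnesses. \<open>sig_or\<close> uses
  \<open>sig_exn\<close> in the same way.\<close>

lemma sig_and:
  assumes "sig P" "sig Q" shows "sig (\<lambda>X. P X \<and> Q X)"
proof -
  have "sig (\<lambda>X. \<forall>n::nat. if n = 0 then P X else Q X)"
    by (intro sig_all sig_if cf_intros sig_sub[OF assms(1)] sig_sub[OF assms(2)] sub_shift)
  moreover have "(\<forall>n::nat. if n = 0 then p else q) \<longleftrightarrow> p \<and> q" for p q
    by (metis zero_neq_one)
  ultimately show ?thesis by simp
qed

lemma sig_or:
  assumes "sig P" "sig Q" shows "sig (\<lambda>X. P X \<or> Q X)"
proof -
  have "sig (\<lambda>X. \<exists>n::nat. if n = 0 then P X else Q X)"
    by (intro sig_exn sig_if cf_intros sig_sub[OF assms(1)] sig_sub[OF assms(2)] sub_shift)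
  moreover have "(\<exists>n::nat. if n = 0 then p else q) \<longleftrightarrow> p \<or> q" for p q
    by (metis zero_neq_one)
  ultimately show ?thesis by simp
qed

lemma sig_imp: "dec P \<Longrightarrow> sig Q \<Longrightarrow> sig (\<lambda>X. P X \<longrightarrow> Q X)"
  using sig_if[of P Q "\<lambda>_. True"] sig_dec[OF dec_True] by (simp add: if_bool_eq_conj)

lemma sig_not_pi:
  assumes "pi P" shows "sig (\<lambda>X. \<not> P X)"
proof -
  obtain D where D: "dec D" "\<And>X. P X \<longleftrightarrow> (\<forall>n. D (num n ## X))"
    using assms unfolding pi_def by blast
  have "sig (\<lambda>X. \<exists>n. \<not> D (num n ## X))"
    by (intro sig_exn sig_dec dec_not dec_sub[OF D(1)] sub_intros cf_intros)
  then show ?thesis using D(2) by simp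
qed

lemmas sig_intros = sig_ex sig_exn sig_all

section \<open>Continuity\<close>

text \<open>\<open>look\<close> reads s as partial information about z: 0 stands for an unknown
  value and \<open>Suc v\<close> for the known value v.\<close>

definition approx :: "(nat \<Rightarrow> nat \<Rightarrow> nat) \<Rightarrow> nat \<Rightarrow> baire \<Rightarrow> bool" where
  "approx look s z \<longleftrightarrow> (\<forall>i. look s i = 0 \<or> look s i = Suc (z i))"

lemma dec_Bex_list: "\<forall>g\<in>set gs. cf (G g) \<Longrightarrow> dec (\<lambda>X. \<exists>g\<in>set gs. G g X = 0)"
  by (induction gs) (auto intro: dec_False dec_or dec_0)

text \<open>A finite use principle for the oracle at index 0. \<open>\<Psi>\<close> runs the
  functional on partial information, with 0 for "not yet determined" and a successor for a definite
  value: the second clause is soundness, the third says that enough information determines the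
  value.\<close>

lemma cf_modulus:
  assumes look: "rec2 look" and "cf \<Phi>"
  shows "\<exists>\<Psi>. cf \<Psi>
    \<and> (\<forall>s z X. approx look s z \<longrightarrow> \<Psi> (num s ## X) = 0 \<or> \<Psi> (num s ## X) = Suc (\<Phi> (z ## X)))
    \<and> (\<forall>z X. \<exists>l. \<forall>s. approx look s z \<longrightarrow> (\<forall>i<l. look s i \<noteq> 0) \<longrightarrow> \<Psi> (num s ## X) \<noteq> 0)"
  using assms(2)
proof induction
  case (app h i)
  then obtain \<Psi> where \<Psi>: "cf \<Psi>"
    "\<And>s z X. approx look s z \<Longrightarrow> \<Psi> (num s ## X) = 0 \<or> \<Psi> (num s ## X) = Suc (h (z ## X))"
    "\<And>z X. \<exists>l. \<forall>s. approx look s z \<longrightarrow> (\<forall>i<l. look s i \<noteq> 0) \<longrightarrow> \<Psi> (num s ## X) \<noteq> 0"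
    by blast
  show ?case
  proof (cases i)
    case 0
    let ?\<Theta> = "\<lambda>X. if \<Psi> X = 0 then 0 else look (X 0 0) (\<Psi> X - 1)"
    have "cf ?\<Theta>" by (intro cf_if dec_0 cf_intros cf_2[OF look] \<Psi>(1))
    moreover have "?\<Theta> (num s ## X) = 0 \<or> ?\<Theta> (num s ## X) = Suc ((z ## X) i (h (z ## X)))"
      if "approx look s z" for s z X
      using \<Psi>(2)[OF that, of X] that by (auto simp: 0 approx_def)
    moreover have "\<exists>l. \<forall>s. approx look s z \<longrightarrow> (\<forall>i<l. look s i \<noteq> 0) \<longrightarrow> ?\<Theta> (num s ## X) \<noteq> 0" for z X
    proof -
      obtain l where l: "\<And>s. approx look s z \<Longrightarrow> (\<forall>i<l. look s i \<noteq> 0) \<Longrightarrow> \<Psi> (num s ## X) \<noteq> 0"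
        using \<Psi>(3) by meson
      \<comment> \<open>The bound \<open>l\<close> secures the position of the query, and
        \<open>Suc\<close> of that position secures the answer.\<close>
      have "?\<Theta> (num s ## X) \<noteq> 0" if s: "approx look s z" "\<forall>i<max l (Suc (h (z ## X))). look s i \<noteq> 0" for s
      proof -
        have "\<Psi> (num s ## X) = Suc (h (z ## X))" using l[of s] \<Psi>(2)[of s z X] s by simp
        then show ?thesis using s(2) by simp
      qed
      then show ?thesis by blast
    qed
    ultimately show ?thesis by (intro exI[of _ ?\<Theta>]) simp
  next
    case (Suc j)
    \<comment> \<open>The other oracles remain total, so only the position of the query can be
      undetermined.\<close>
    let ?\<Theta> = "\<lambda>X. if \<Psi> X = 0 then 0 else Suc (X (Suc j) (\<Psi> X - 1))"
    have "cf ?\<Theta>" by (intro cf_if dec_0 cf_intros \<Psi>(1))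
    moreover have "?\<Theta> (num s ## X) = 0 \<or> ?\<Theta> (num s ## X) = Suc ((z ## X) i (h (z ## X)))"
      if "approx look s z" for s z X
      using \<Psi>(2)[OF that, of X] by (auto simp: Suc)
    moreover have "\<exists>l. \<forall>s. approx look s z \<longrightarrow> (\<forall>i<l. look s i \<noteq> 0) \<longrightarrow> ?\<Theta> (num s ## X) \<noteq> 0" for z X
    proof -
      have "?\<Theta> Y \<noteq> 0 \<longleftrightarrow> \<Psi> Y \<noteq> 0" for Y by simp
      then show ?thesis using \<Psi>(3)[of z X] by presburger
    qed
    ultimately show ?thesis by (intro exI[of _ ?\<Theta>]) simp
  qed
next
  case (rec gs f)
  then have "\<forall>g\<in>set gs. \<exists>\<Psi>. cf \<Psi>
    \<and> (\<forall>s z X. approx look s z \<longrightarrow> \<Psi> (num s ## X) = 0 \<or> \<Psi> (num s ## X) = Suc (g (z ## X)))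
    \<and> (\<forall>z X. \<exists>l. \<forall>s. approx look s z \<longrightarrow> (\<forall>i<l. look s i \<noteq> 0) \<longrightarrow> \<Psi> (num s ## X) \<noteq> 0)" by blast
  from bchoice[OF this] obtain G where "\<forall>g\<in>set gs. cf (G g)
    \<and> (\<forall>s z X. approx look s z \<longrightarrow> G g (num s ## X) = 0 \<or> G g (num s ## X) = Suc (g (z ## X)))
    \<and> (\<forall>z X. \<exists>l. \<forall>s. approx look s z \<longrightarrow> (\<forall>i<l. look s i \<noteq> 0) \<longrightarrow> G g (num s ## X) \<noteq> 0)" ..
  then have G: "\<And>g. g \<in> set gs \<Longrightarrow> cf (G g)"
    "\<And>g s z X. g \<in> set gs \<Longrightarrow> approx look s z \<Longrightarrow>
      G g (num s ## X) = 0 \<or> G g (num s ## X) = Suc (g (z ## X))"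
    "\<And>g z X. g \<in> set gs \<Longrightarrow> \<exists>l. \<forall>s. approx look s z \<longrightarrow> (\<forall>i<l. look s i \<noteq> 0) \<longrightarrow> G g (num s ## X) \<noteq> 0"
    by blast+
  let ?\<Theta> = "\<lambda>X. if \<exists>g\<in>set gs. G g X = 0 then 0 else Suc (f (map (\<lambda>g. G g X - 1) gs))"
  have "cf (\<lambda>X. f (map (\<lambda>g. g X) (map (\<lambda>g X. G g X - 1) gs)))"
    using rec cf_1[OF rec1_pred G(1)] by (intro cf.rec) (auto simp del: One_nat_def)
  then have "cf (\<lambda>X. f (map (\<lambda>g. G g X - 1) gs))" by (simp add: comp_def)
  then have "cf ?\<Theta>" by (intro cf_if dec_Bex_list ballI cf_const G(1) cf_1[OF rec1_Suc])
  moreover have "?\<Theta> (num s ## X) = 0 \<or> ?\<Theta> (num s ## X) = Suc (f (map (\<lambda>g. g (z ## X)) gs))"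
    if s: "approx look s z" for s z X
  proof (cases "\<exists>g\<in>set gs. G g (num s ## X) = 0")
    case False
    have "G g (num s ## X) - 1 = g (z ## X)" if g: "g \<in> set gs" for g
      using G(2)[OF g s, of X] False g by force
    then have "map (\<lambda>g. G g (num s ## X) - 1) gs = map (\<lambda>g. g (z ## X)) gs" by simp
    then show ?thesis using False by metis
  qed simp
  moreover have "\<exists>l. \<forall>s. approx look s z \<longrightarrow> (\<forall>i<l. look s i \<noteq> 0) \<longrightarrow> ?\<Theta> (num s ## X) \<noteq> 0" for z X
  proof -
    obtain L where L: "\<And>g s. g \<in> set gs \<Longrightarrow> approx look s z \<Longrightarrow> (\<forall>i<L g. look s i \<noteq> 0) \<Longrightarrow> G g (num s ## X) \<noteq> 0"
      using G(3)[of _ z X] by metis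
    define l where "l = Max (insert 0 (L ` set gs))"
    have "L g \<le> l" if "g \<in> set gs" for g unfolding l_def using that by (intro Max_ge) auto
    then have "?\<Theta> (num s ## X) \<noteq> 0" if "approx look s z" "\<forall>i<l. look s i \<noteq> 0" for s
      using L[of _ s] that by fastforce
    then show ?thesis by blast
  qed
  ultimately show ?case by (intro exI[of _ ?\<Theta>]) simp
qed

text \<open>Two readings of the same codes: \<open>look_fwd\<close> matches the cylinders
  \<open>baire_nbhd\<close>, whereas \<open>look_rev\<close> takes the head of the list as the
  newest term.\<close>

definition look_fwd :: "nat \<Rightarrow> nat \<Rightarrow> nat" where
  "look_fwd s i = (if i < length (list_decode s) then Suc (lnth s i) else 0)"

definition look_rev :: "nat \<Rightarrow> nat \<Rightarrow> nat" where
  "look_rev s i = (if i < length (list_decode s) then Suc (lnth s (length (list_decode s) - Suc i)) else 0)"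

lemma rec2_less_if:
  assumes "rec2 f" "rec2 g" "rec2 h"
  shows "rec2 (\<lambda>a b. if f a b < g a b then h a b else 0)"
proof -
  have "rec2 (\<lambda>a b. if g a b - f a b = 0 then 0 else h a b)"
    unfolding rec2_def
    by (intro recf_3[OF rec3_if] recf_2[OF rec2_diff] recf_2[OF assms(1)] recf_2[OF assms(2)]
      recf_2[OF assms(3)] recf_basic) auto
  then show ?thesis by (rule rec2_cong) auto
qed

lemma rec2_look_fwd: "rec2 look_fwd"
  unfolding look_fwd_def[abs_def]
  by (intro rec2_less_if; subst rec2_def)
    (intro recf_1[OF rec1_length] recf_1[OF rec1_Suc] recf_2[OF rec2_lnth] recf_basic; simp)+

lemma rec2_look_rev: "rec2 look_rev"
  unfolding look_rev_def[abs_def]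
  by (intro rec2_less_if; subst rec2_def)
    (intro recf_1[OF rec1_length] recf_1[OF rec1_Suc] recf_2[OF rec2_lnth] recf_2[OF rec2_diff] recf_basic; simp)+

text \<open>Codes of finite sequences are read backwards here, so that the one-term extensions of \<open>s\<close> are
  the numbers \<open>Suc (pr x s)\<close>.\<close>

primrec rseg :: "baire \<Rightarrow> nat \<Rightarrow> nat" where
  "rseg z 0 = 0"
| "rseg z (Suc l) = Suc (pr (z l) (rseg z l))"

lemma list_decode_rseg: "list_decode (rseg z l) = rev (map z [0..<l])"
  by (induction l) auto

lemma approx_rseg: "approx look_rev (rseg z l) z" and look_rseg: "i < l \<Longrightarrow> look_rev (rseg z l) i \<noteq> 0"
  by (auto simp: approx_def look_rev_def list_decode_rseg rev_nth)

text \<open>Puts an analytic predicate in the form "some real has all its initial segments accepted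
  by a decidable test".\<close>

lemma sig_tree:
  assumes "sig P"
  shows "\<exists>D. dec D \<and> (\<forall>X. P X \<longleftrightarrow> (\<exists>z. \<forall>l. D (num (rseg z l) ## X)))"
proof -
  obtain D where D: "dec D" "\<And>X. P X \<longleftrightarrow> (\<exists>z. \<forall>n. D (z ## num n ## X))"
    using assms unfolding sig_def by blast
  from cf_modulus[OF rec2_look_rev D(1)[unfolded dec_def]] obtain \<Psi> where \<Psi>: "cf \<Psi>"
    "\<And>s z X. approx look_rev s z \<Longrightarrow> \<Psi> (num s ## X) = 0 \<or> \<Psi> (num s ## X) = Suc (if D (z ## X) then 0 else 1)"
    "\<And>z X. \<exists>l. \<forall>s. approx look_rev s z \<longrightarrow> (\<forall>i<l. look_rev s i \<noteq> 0) \<longrightarrow> \<Psi> (num s ## X) \<noteq> 0"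
    by blast
  \<comment> \<open>A segment of length l tests only the number \<open>p1 l\<close>, and it is
    rejected only if refuted outright: \<open>\<Psi>\<close> gives 0 for undecided, 1 for true, 2
    for false.\<close>
  let ?E = "\<lambda>X. \<Psi> (num (X 0 0) ## num (p1 (length (list_decode (X 0 0)))) ## (\<lambda>i. X (Suc i))) \<le> 1"
  have "dec ?E"
    by (intro dec_le cf_sub[OF \<Psi>(1)] sub_intros cf_intros)
  moreover have "P X \<longleftrightarrow> (\<exists>z. \<forall>l. ?E (num (rseg z l) ## X))" for X
  proof -
    have "(\<forall>n. D (z ## num n ## X)) \<longleftrightarrow> (\<forall>l. ?E (num (rseg z l) ## X))" for z
    proof
      assume *: "\<forall>n. D (z ## num n ## X)"
      show "\<forall>l. ?E (num (rseg z l) ## X)"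
      proof
        fix l
        show "?E (num (rseg z l) ## X)"
          using \<Psi>(2)[OF approx_rseg[of z l], of "num (p1 l) ## X"] * by (auto simp: list_decode_rseg)
      qed
    next
      assume *: "\<forall>l. ?E (num (rseg z l) ## X)"
      show "\<forall>n. D (z ## num n ## X)"
      proof
        fix n
        obtain k where k: "\<And>s. approx look_rev s z \<Longrightarrow> (\<forall>i<k. look_rev s i \<noteq> 0) \<Longrightarrow> \<Psi> (num s ## num n ## X) \<noteq> 0"
          using \<Psi>(3) by meson
        \<comment> \<open>This length tests n and is at least k, hence long enough for a
          decision.\<close>
        let ?l = "pr n k"
        have "k \<le> ?l" by (rule le_prod_encode_2)
        then have "\<Psi> (num (rseg z ?l) ## num n ## X) \<noteq> 0"
          by (intro k approx_rseg allI impI look_rseg) simp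
        moreover have "\<Psi> (num (rseg z ?l) ## num n ## X) \<le> 1"
          using *[rule_format, of ?l] by (simp add: list_decode_rseg)
        ultimately show "D (z ## num n ## X)"
          using \<Psi>(2)[OF approx_rseg[of z ?l], of "num n ## X"] by (auto split: if_splits)
      qed
    qed
    then show ?thesis using D(2) by simp
  qed
  ultimately show ?thesis by blast
qed

section \<open>Coreduction of \<open>\<Sigma>\<^sup>1\<^sub>1\<close> predicates\<close>

text \<open>A strategy is represented by a set of safe positions (p, q). Here the player in
  \<open>T\<close> answers every move made in \<open>S\<close>; in \<open>leads\<close> the player
  in \<open>S\<close> moves first in each round.\<close>

definition follows :: "(nat \<Rightarrow> bool) \<Rightarrow> (nat \<Rightarrow> bool) \<Rightarrow> (nat \<Rightarrow> nat \<Rightarrow> bool) \<Rightarrow> bool" where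
  "follows S T G \<longleftrightarrow> G 0 0 \<and> (\<forall>p q x. G p q \<and> S (Suc (pr x p)) \<longrightarrow>
     (\<exists>y. T (Suc (pr y q)) \<and> G (Suc (pr x p)) (Suc (pr y q))))"

definition leads :: "(nat \<Rightarrow> bool) \<Rightarrow> (nat \<Rightarrow> bool) \<Rightarrow> (nat \<Rightarrow> nat \<Rightarrow> bool) \<Rightarrow> bool" where
  "leads S T H \<longleftrightarrow> H 0 0 \<and> (\<forall>p q. H p q \<longrightarrow> (\<exists>x. S (Suc (pr x p)) \<and>
     (\<forall>y. T (Suc (pr y q)) \<longrightarrow> H (Suc (pr x p)) (Suc (pr y q)))))"

text \<open>The largest set of positions safe for the answering player.\<close>

coinductive sim :: "(nat \<Rightarrow> bool) \<Rightarrow> (nat \<Rightarrow> bool) \<Rightarrow> nat \<Rightarrow> nat \<Rightarrow> bool" for S T where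
  "(\<And>x. S (Suc (pr x p)) \<Longrightarrow> \<exists>y. T (Suc (pr y q)) \<and> sim S T (Suc (pr x p)) (Suc (pr y q))) \<Longrightarrow> sim S T p q"

text \<open>Determinacy of the game. Outside the greatest fixed point \<open>sim\<close> some legal
  move leaves no answer inside \<open>sim\<close>, so its complement is safe for the leading
  player.\<close>

lemma follows_or_leads: "(\<exists>G. follows S T G) \<or> (\<exists>H. leads S T H)"
proof (cases "sim S T 0 0")
  case True
  then have "follows S T (sim S T)" unfolding follows_def by (auto elim: sim.cases)
  then show ?thesis by blast
next
  case False
  then have "leads S T (\<lambda>p q. \<not> sim S T p q)" unfolding leads_def using sim.intros[of S _ T] by blast
  then show ?thesis by blast
qed

text \<open>The player ignores the opponent and climbs the infinite branch z. The same works for the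
  leading player.\<close>

lemma path_follows: "\<forall>l. T (rseg z (Suc l)) \<Longrightarrow> \<exists>G. follows S T G"
  unfolding follows_def by (rule exI[of _ "\<lambda>p q. \<exists>l. q = rseg z l"]) (fastforce intro: exI[of _ 0] exI[of _ "Suc _"])

lemma path_leads: "\<forall>l. S (rseg z (Suc l)) \<Longrightarrow> \<exists>H. leads S T H"
  unfolding leads_def by (rule exI[of _ "\<lambda>p q. \<exists>l. p = rseg z l"]) (fastforce intro: exI[of _ 0] exI[of _ "Suc _"])

text \<open>Two never-losing strategies are played against each other. Neither player gets stuck,
  and the infinite play traces a branch through each tree.\<close>

lemma follows_leads_paths:
  assumes G: "follows S T G" and H: "leads S T H"
  obtains z w where "\<And>l. S (rseg z (Suc l))" "\<And>l. T (rseg w (Suc l))"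
proof -
  let ?R = "\<lambda>p q p' q'. G p' q' \<and> H p' q' \<and> S p' \<and> T q' \<and> (\<exists>x y. p' = Suc (pr x p) \<and> q' = Suc (pr y q))"
  have step: "\<exists>p' q'. ?R p q p' q'" if "G p q" "H p q" for p q
    using that G H unfolding follows_def leads_def by metis
  \<comment> \<open>Dependent choice produces the play; the clause for n = 0 pins its start to the
    two roots.\<close>
  have "\<exists>f. \<forall>n. (case f n of (p, q) \<Rightarrow> G p q \<and> H p q \<and> (n = 0 \<longrightarrow> p = 0 \<and> q = 0)) \<and>
     (case f n of (p, q) \<Rightarrow> case f (Suc n) of (p', q') \<Rightarrow> ?R p q p' q')"
  proof (rule dependent_nat_choice)
    show "\<exists>x. case x of (p, q) \<Rightarrow> G p q \<and> H p q \<and> ((0::nat) = 0 \<longrightarrow> p = 0 \<and> q = 0)"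
      using G H unfolding follows_def leads_def by auto
  qed (use step in fastforce)
  then obtain f where f: "\<And>n. (case f n of (p, q) \<Rightarrow> G p q \<and> H p q \<and> (n = 0 \<longrightarrow> p = 0 \<and> q = 0)) \<and>
     (case f n of (p, q) \<Rightarrow> case f (Suc n) of (p', q') \<Rightarrow> ?R p q p' q')" by blast
  define a where "a n = fst (f n)" for n
  define b where "b n = snd (f n)" for n
  have 0: "a 0 = 0" "b 0 = 0" using f[of 0] by (auto simp: a_def b_def split: prod.splits)
  have R: "?R (a n) (b n) (a (Suc n)) (b (Suc n))" for n
    using f[of n] by (auto simp: a_def b_def split: prod.splits)
  then obtain z w where zw: "\<And>n. a (Suc n) = Suc (pr (z n) (a n)) \<and> b (Suc n) = Suc (pr (w n) (b n))"
    by metis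
  have "a n = rseg z n" "b n = rseg w n" for n by (induction n) (simp_all add: 0 zw)
  then show ?thesis using R that by metis
qed

lemma indicator_eq_0: "(if b then 0 else 1) = (0::nat) \<longleftrightarrow> b"
  by simp

section \<open>The existence of either strategy is an analytic condition\<close>

lemma sig_follows:
  assumes "dec S" "dec T"
  shows "sig (\<lambda>X. \<exists>G. follows (\<lambda>s. S (num s ## X)) (\<lambda>s. T (num s ## X)) G)"
proof -
  \<comment> \<open>The set of positions becomes a real with value 0 for membership, so one real
    quantifier is followed by number quantifiers, and the premises of the implications are
    decidable.\<close>
  have "sig (\<lambda>X. \<exists>g::baire. g (pr 0 0) = 0 \<and> (\<forall>p q x. g (pr p q) = 0 \<and> S (num (Suc (pr x p)) ## X) \<longrightarrow>
     (\<exists>y. T (num (Suc (pr y q)) ## X) \<and> g (pr (Suc (pr x p)) (Suc (pr y q))) = 0)))"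
    by (intro sig_intros sig_and sig_imp sig_dec dec_sub[OF assms(1)] dec_sub[OF assms(2)] sub_intros cf_intros)
  moreover have "(\<exists>G. follows S T G) \<longleftrightarrow>
     (\<exists>g::baire. g (pr 0 0) = 0 \<and> (\<forall>p q x. g (pr p q) = 0 \<and> S (Suc (pr x p)) \<longrightarrow>
       (\<exists>y. T (Suc (pr y q)) \<and> g (pr (Suc (pr x p)) (Suc (pr y q))) = 0)))" for S T
  proof
    assume "\<exists>G. follows S T G"
    then obtain G where "follows S T G" by blast
    then show "\<exists>g::baire. g (pr 0 0) = 0 \<and> (\<forall>p q x. g (pr p q) = 0 \<and> S (Suc (pr x p)) \<longrightarrow>
       (\<exists>y. T (Suc (pr y q)) \<and> g (pr (Suc (pr x p)) (Suc (pr y q))) = 0))"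
      by (intro exI[of _ "\<lambda>n. if G (p1 n) (p2 n) then 0 else 1"]) (simp only: follows_def prod_encode_inverse fst_conv snd_conv indicator_eq_0, blast)
  next
    assume "\<exists>g::baire. g (pr 0 0) = 0 \<and> (\<forall>p q x. g (pr p q) = 0 \<and> S (Suc (pr x p)) \<longrightarrow>
       (\<exists>y. T (Suc (pr y q)) \<and> g (pr (Suc (pr x p)) (Suc (pr y q))) = 0))"
    then show "\<exists>G. follows S T G"
      unfolding follows_def by (elim exE) (rule_tac x="\<lambda>p q. g (pr p q) = 0" in exI, blast)
  qed
  ultimately show ?thesis by simp
qed

lemma sig_leads:
  assumes "dec S" "dec T"
  shows "sig (\<lambda>X. \<exists>H. leads (\<lambda>s. S (num s ## X)) (\<lambda>s. T (num s ## X)) H)"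
proof -
  have "sig (\<lambda>X. \<exists>h::baire. h (pr 0 0) = 0 \<and> (\<forall>p q. h (pr p q) = 0 \<longrightarrow> (\<exists>x. S (num (Suc (pr x p)) ## X) \<and>
     (\<forall>y. T (num (Suc (pr y q)) ## X) \<longrightarrow> h (pr (Suc (pr x p)) (Suc (pr y q))) = 0))))"
    by (intro sig_intros sig_and sig_imp sig_dec dec_sub[OF assms(1)] dec_sub[OF assms(2)] sub_intros cf_intros)
  moreover have "(\<exists>H. leads S T H) \<longleftrightarrow>
     (\<exists>h::baire. h (pr 0 0) = 0 \<and> (\<forall>p q. h (pr p q) = 0 \<longrightarrow> (\<exists>x. S (Suc (pr x p)) \<and>
     (\<forall>y. T (Suc (pr y q)) \<longrightarrow> h (pr (Suc (pr x p)) (Suc (pr y q))) = 0))))" for S T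
  proof
    assume "\<exists>H. leads S T H"
    then obtain H where "leads S T H" by blast
    then show "\<exists>h::baire. h (pr 0 0) = 0 \<and> (\<forall>p q. h (pr p q) = 0 \<longrightarrow> (\<exists>x. S (Suc (pr x p)) \<and>
     (\<forall>y. T (Suc (pr y q)) \<longrightarrow> h (pr (Suc (pr x p)) (Suc (pr y q))) = 0)))"
      by (intro exI[of _ "\<lambda>n. if H (p1 n) (p2 n) then 0 else 1"]) (simp only: leads_def prod_encode_inverse fst_conv snd_conv indicator_eq_0, blast)
  next
    assume "\<exists>h::baire. h (pr 0 0) = 0 \<and> (\<forall>p q. h (pr p q) = 0 \<longrightarrow> (\<exists>x. S (Suc (pr x p)) \<and>
     (\<forall>y. T (Suc (pr y q)) \<longrightarrow> h (pr (Suc (pr x p)) (Suc (pr y q))) = 0)))"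
    then show "\<exists>H. leads S T H"
      unfolding leads_def by (elim exE) (rule_tac x="\<lambda>p q. h (pr p q) = 0" in exI, blast)
  qed
  ultimately show ?thesis by simp
qed

theorem coreduction:
  assumes "sig P" "sig Q"
  obtains P' Q' where "sig P'" "sig Q'" "\<And>X. P X \<Longrightarrow> P' X" "\<And>X. Q X \<Longrightarrow> Q' X"
    "\<And>X. P' X \<or> Q' X" "\<And>X. P' X \<Longrightarrow> Q' X \<Longrightarrow> P X \<and> Q X"
proof -
  \<comment> \<open>The games test a node only after a move, hence never the root. The test at the
    root is therefore added to the test at every node.\<close>
  have root: "\<exists>D. dec D \<and> (\<forall>X. P X \<longleftrightarrow> (\<exists>z. \<forall>l. D (num (rseg z (Suc l)) ## X)))" if P: "sig P" for P
  proof -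
    obtain D where D: "dec D" "\<And>X. P X \<longleftrightarrow> (\<exists>z. \<forall>l. D (num (rseg z l) ## X))"
      using sig_tree[OF P] by blast
    have "dec (\<lambda>X. D X \<and> D (num 0 ## (\<lambda>i. X (Suc i))))"
      by (intro dec_and D(1) dec_sub[OF D(1)] sub_intros cf_intros)
    moreover have "(\<forall>l. Q (rseg z l)) \<longleftrightarrow> (\<forall>l. Q (rseg z (Suc l)) \<and> Q 0)" for Q z
      by (metis not0_implies_Suc rseg.simps(1))
    from this[of "\<lambda>s. D (num s ## _)"]
    have "P X \<longleftrightarrow> (\<exists>z. \<forall>l. D (num (rseg z (Suc l)) ## X) \<and> D (num 0 ## X))" for X
      unfolding D(2) by presburger
    ultimately show ?thesis
      by (intro exI[of _ "\<lambda>X. D X \<and> D (num 0 ## (\<lambda>i. X (Suc i)))"] conjI) auto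
  qed
  obtain S where S: "dec S" "\<And>X. P X \<longleftrightarrow> (\<exists>z. \<forall>l. S (num (rseg z (Suc l)) ## X))"
    using root[OF assms(1)] by blast
  obtain T where T: "dec T" "\<And>X. Q X \<longleftrightarrow> (\<exists>z. \<forall>l. T (num (rseg z (Suc l)) ## X))"
    using root[OF assms(2)] by blast
  let ?P' = "\<lambda>X. \<exists>H. leads (\<lambda>s. S (num s ## X)) (\<lambda>s. T (num s ## X)) H"
  let ?Q' = "\<lambda>X. \<exists>G. follows (\<lambda>s. S (num s ## X)) (\<lambda>s. T (num s ## X)) G"
  show ?thesis
  proof (rule that[of ?P' ?Q'])
    show "sig ?P'" "sig ?Q'" using sig_leads sig_follows S(1) T(1) by blast+
  next
    fix X assume "P X"
    then obtain z where "\<forall>l. S (num (rseg z (Suc l)) ## X)" using S(2) by blast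
    then show "?P' X" by (rule path_leads)
  next
    fix X assume "Q X"
    then obtain z where "\<forall>l. T (num (rseg z (Suc l)) ## X)" using T(2) by blast
    then show "?Q' X" by (rule path_follows)
  next
    fix X show "?P' X \<or> ?Q' X" using follows_or_leads by blast
  next
    fix X assume "?P' X" "?Q' X"
    then obtain G H where "follows (\<lambda>s. S (num s ## X)) (\<lambda>s. T (num s ## X)) G"
      "leads (\<lambda>s. S (num s ## X)) (\<lambda>s. T (num s ## X)) H" by blast
    then obtain z w where "\<And>l. S (num (rseg z (Suc l)) ## X)" "\<And>l. T (num (rseg w (Suc l)) ## X)"
      by (rule follows_leads_paths) blast
    then show "P X \<and> Q X" unfolding S(2) T(2) by blast
  qed
qed

section \<open>Closed sets of reals\<close>

text \<open>Once all oracles are constant, a query merely returns a number, and only compositions of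
  recursive functions remain.\<close>

lemma cf_recf: "cf \<Psi> \<Longrightarrow> recf 2 (\<lambda>xs. \<Psi> (num (xs ! 0) ## num (xs ! 1) ## (\<lambda>i. num (u i))))"
proof (induction rule: cf.induct)
  case (app h i)
  consider "i = 0" | "i = 1" | j where "i = Suc (Suc j)" by (metis One_nat_def not0_implies_Suc)
  then show ?case by cases (simp_all add: recf_proj recf_const)
next
  case (rec gs f)
  then have "recf 2 (\<lambda>xs. f (map (\<lambda>g. g xs) (map (\<lambda>g xs. g (num (xs ! 0) ## num (xs ! 1) ## (\<lambda>i. num (u i)))) gs)))"
    by (intro recf_comp) (auto simp del: One_nat_def)
  then show ?case by (simp add: comp_def del: One_nat_def)
qed

lemma mem_baire_nbhd: "x \<in> baire_nbhd s \<longleftrightarrow> approx look_fwd s x"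
  by (auto simp: baire_nbhd_def approx_def look_fwd_def)

lemma pi_Pi01:
  assumes "pi P"
  shows "Pi01 baire_nbhd {x. P (x ## (\<lambda>i. num (u i)))}"
proof -
  obtain D where D: "dec D" "\<And>X. P X \<longleftrightarrow> (\<forall>n. D (num n ## X))"
    using assms unfolding pi_def by blast
  let ?U = "\<lambda>i. num (u i)"
  \<comment> \<open>The real goes to index 0, where \<open>cf_modulus\<close> approximates; the
    number n goes to index 1.\<close>
  have "dec (\<lambda>X. D (X 1 ## X 0 ## (\<lambda>i. X (i + 2))))"
    by (intro dec_sub[OF D(1)] sub_intros cf_intros)
  from cf_modulus[OF rec2_look_fwd this[unfolded dec_def]] obtain \<Psi> where \<Psi>: "cf \<Psi>"
    "\<And>s z X. approx look_fwd s z \<Longrightarrow> \<Psi> (num s ## X) = 0 \<or>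
      \<Psi> (num s ## X) = Suc (if D (X 0 ## z ## (\<lambda>i. X (Suc i))) then 0 else 1)"
    "\<And>z X. \<exists>l. \<forall>s. approx look_fwd s z \<longrightarrow> (\<forall>i<l. look_fwd s i \<noteq> 0) \<longrightarrow> \<Psi> (num s ## X) \<noteq> 0"
    by auto
  have "cf (\<lambda>X. if 2 \<le> \<Psi> X then 0 else 1)" by (intro cf_intros \<Psi>(1))
  from cf_recf[OF this, of u] obtain f where f: "recursive_fn 2 f"
    "\<And>xs. length xs = 2 \<Longrightarrow> f xs = (if 2 \<le> \<Psi> (num (xs ! 0) ## num (xs ! 1) ## ?U) then 0 else 1)"
    unfolding recf_def by blast
  \<comment> \<open>The cylinders on which the finite information s already refutes \<open>D\<close>
    for some n; the value 2 of \<open>\<Psi>\<close> means refuted.\<close>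
  define W where "W = {s. \<exists>n. f [s, n] = 0}"
  have W: "s \<in> W \<longleftrightarrow> (\<exists>n. 2 \<le> \<Psi> (num s ## num n ## ?U))" for s
    by (simp add: W_def f(2))
  have "- {x. P (x ## ?U)} = (\<Union>s\<in>W. baire_nbhd s)"
  proof (rule set_eqI)
    fix x
    show "x \<in> - {x. P (x ## ?U)} \<longleftrightarrow> x \<in> (\<Union>s\<in>W. baire_nbhd s)"
    proof
      assume "x \<in> - {x. P (x ## ?U)}"
      then obtain n where n: "\<not> D (num n ## x ## ?U)" using D(2) by auto
      obtain l where l: "\<And>s. approx look_fwd s x \<Longrightarrow> (\<forall>i<l. look_fwd s i \<noteq> 0) \<Longrightarrow>
        \<Psi> (num s ## num n ## ?U) \<noteq> 0" using \<Psi>(3) by meson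
      define s where "s = list_encode (map x [0..<l])"
      have a: "approx look_fwd s x" by (simp add: approx_def look_fwd_def s_def)
      have "\<forall>i<l. look_fwd s i \<noteq> 0" by (simp add: look_fwd_def s_def)
      then have "\<Psi> (num s ## num n ## ?U) = 2" using l[OF a] \<Psi>(2)[OF a, of "num n ## ?U"] n by simp
      then have "s \<in> W" using W[of s] by (metis order_refl)
      then show "x \<in> (\<Union>s\<in>W. baire_nbhd s)" using a mem_baire_nbhd by blast
    next
      assume "x \<in> (\<Union>s\<in>W. baire_nbhd s)"
      then obtain s n where s: "approx look_fwd s x" "2 \<le> \<Psi> (num s ## num n ## ?U)"
        using W mem_baire_nbhd by blast
      then have "\<not> D (num n ## x ## ?U)" using \<Psi>(2)[OF s(1), of "num n ## ?U"] by (auto split: if_splits)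
      then show "x \<in> - {x. P (x ## ?U)}" using D(2) by auto
    qed
  qed
  moreover have "rec_enumerable W" unfolding rec_enumerable_def W_def using f(1) by blast
  ultimately show ?thesis unfolding Pi01_def Sigma01_def by blast
qed

section \<open>A total evaluator\<close>

text \<open>With a = \<open>p1 i\<close> and b = \<open>p2 i\<close>, the code i is
  \<open>triangle (a + b) + a\<close>, which is at least a + b + a and so exceeds b if a is nonzero.
  The termination of \<open>EV\<close> rests on this.\<close>

lemma prod_code_less: "p1 i \<noteq> 0 \<Longrightarrow> p1 (p2 i) < i" "p1 i \<noteq> 0 \<Longrightarrow> p2 (p2 i) < i"
proof -
  assume k: "p1 i \<noteq> 0"
  have tri: "n \<le> triangle n" for n by (induction n) auto
  have "pr (p1 i) (p2 i) = triangle (p1 i + p2 i) + p1 i"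
    by (simp only: prod_encode_def case_prod_conv)
  then have "i = triangle (p1 i + p2 i) + p1 i" by simp
  then have "p2 i < i" using k tri[of "p1 i + p2 i"] by linarith
  moreover have "p1 (p2 i) \<le> p2 i" "p2 (p2 i) \<le> p2 i"
    by (metis le_prod_encode_1 le_prod_encode_2 prod.collapse prod_decode_inverse)+
  ultimately show "p1 (p2 i) < i" "p2 (p2 i) < i" by auto
qed

definition base :: "baire \<Rightarrow> nat \<Rightarrow> nat \<Rightarrow> nat" where
  "base z a t = (if a = 0 then 0 else if a = 1 then Suc t else if a = 2 then p1 t
     else if a = 3 then p2 t else z t)"

text \<open>The search in the last clause is made total by the value \<open>0\<close>. So \<open>EV\<close> is not recursive, but its graph
  is \<open>\<Pi>\<^sup>0\<^sub>1\<close>, and no question of convergence arises.\<close>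

function EV :: "baire \<Rightarrow> nat \<Rightarrow> nat \<Rightarrow> nat" where
  "EV z i = (
     if p1 i = 0 then base z (p1 (p2 i))
     else if p1 i = 1 then (\<lambda>f g t. f (g t)) (EV z (p1 (p2 i))) (EV z (p2 (p2 i)))
     else if p1 i = 2 then (\<lambda>f g t. pr (f t) (g t)) (EV z (p1 (p2 i))) (EV z (p2 (p2 i)))
     else if p1 i = 3 then (\<lambda>f g t. rec_nat (f (p2 t)) (\<lambda>m r. g (pr m (pr r (p2 t)))) (p1 t))
       (EV z (p1 (p2 i))) (EV z (p2 (p2 i)))
     else (\<lambda>f t. if \<exists>m. f (pr m t) = 0 then LEAST m. f (pr m t) = 0 else 0) (EV z (p1 (p2 i))))"
  by auto
termination by (relation "measure snd") (auto simp: prod_code_less)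

declare EV.simps [simp del]

lemma EV_base: "EV z (pr 0 (pr a b)) t = base z a t"
  and EV_comp: "EV z (pr (Suc 0) (pr a b)) t = EV z a (EV z b t)"
  and EV_pair: "EV z (pr 2 (pr a b)) t = pr (EV z a t) (EV z b t)"
  and EV_rec: "EV z (pr 3 (pr a b)) t = rec_nat (EV z a (p2 t)) (\<lambda>m r. EV z b (pr m (pr r (p2 t)))) (p1 t)"
  by (simp_all add: EV.simps[of z "pr _ _"])

lemma EV_mu:
  "EV z (pr 4 (pr a b)) t = (if \<exists>m. EV z a (pr m t) = 0 then LEAST m. EV z a (pr m t) = 0 else 0)"
  by (simp add: EV.simps[of z "pr _ _"]) (metis less_irrefl)

text \<open>The clauses of \<open>EV\<close> as decidable conditions on a table v. Primitive
  recursion is unrolled by one step within the table, and m is the number over which the unbounded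
  search quantifies.\<close>

definition EV_local :: "baire \<Rightarrow> baire \<Rightarrow> nat \<Rightarrow> nat \<Rightarrow> nat \<Rightarrow> bool" where
  "EV_local z v i t m \<longleftrightarrow> (
     if p1 i = 0 then v (pr i t) = base z (p1 (p2 i)) t
     else if p1 i = 1 then v (pr i t) = v (pr (p1 (p2 i)) (v (pr (p2 (p2 i)) t)))
     else if p1 i = 2 then v (pr i t) = pr (v (pr (p1 (p2 i)) t)) (v (pr (p2 (p2 i)) t))
     else if p1 i = 3 then
       (if p1 t = 0 then v (pr i t) = v (pr (p1 (p2 i)) (p2 t))
        else v (pr i t) = v (pr (p2 (p2 i)) (pr (p1 t - 1) (pr (v (pr i (pr (p1 t - 1) (p2 t)))) (p2 t)))))
     else (v (pr (p1 (p2 i)) (pr (v (pr i t)) t)) = 0 \<or> v (pr i t) = 0 \<and> v (pr (p1 (p2 i)) (pr m t)) \<noteq> 0)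
       \<and> (m < v (pr i t) \<longrightarrow> v (pr (p1 (p2 i)) (pr m t)) \<noteq> 0))"

definition is_EV :: "baire \<Rightarrow> baire \<Rightarrow> bool" where
  "is_EV z v \<longleftrightarrow> (\<forall>i t. v (pr i t) = EV z i t)"

text \<open>Brings the search with default 0 into the form "for all m, a decidable condition". As
  \<open>f k = 0\<close> does not mention m, the quantifier distributes: either k is a zero, or k is
  the default and no zero exists.\<close>

lemma least_total_iff:
  fixes f :: "nat \<Rightarrow> nat"
  shows "k = (if \<exists>m. f m = 0 then LEAST m. f m = 0 else 0) \<longleftrightarrow>
    (\<forall>m. (f k = 0 \<or> k = 0 \<and> f m \<noteq> 0) \<and> (m < k \<longrightarrow> f m \<noteq> 0))"
proof (cases "\<exists>m. f m = 0")
  case True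
  have "k = (LEAST m. f m = 0) \<longleftrightarrow> f k = 0 \<and> (\<forall>m<k. f m \<noteq> 0)"
    using True by (metis (mono_tags, lifting) LeastI_ex Least_le linorder_neqE_nat not_less not_less_Least)
  moreover have "\<not> (\<forall>m. f m \<noteq> 0)" using True by blast
  ultimately show ?thesis by (simp only: True if_True) blast
next
  case False
  then show ?thesis by (auto simp del: neq0_conv bot_nat_0.not_eq_extremum)
qed

lemma is_EV_local: "is_EV z v \<longleftrightarrow> (\<forall>i t m. EV_local z v i t m)"
proof
  assume v: "is_EV z v"
  show "\<forall>i t m. EV_local z v i t m"
  proof (intro allI)
    fix i t m
    have v': "v (pr i t) = EV z i t" for i t using v by (simp add: is_EV_def)
    show "EV_local z v i t m"
    proof (cases "p1 i \<le> 3")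
      case False
      then have "EV z i t = (if \<exists>m. EV z (p1 (p2 i)) (pr m t) = 0 then LEAST m. EV z (p1 (p2 i)) (pr m t) = 0 else 0)"
        by (subst EV.simps) simp
      from this[unfolded least_total_iff] False show ?thesis unfolding EV_local_def v' by simp
    next
      case True
      then have "p1 i = 0 \<or> p1 i = 1 \<or> p1 i = 2 \<or> p1 i = 3" by auto
      moreover have "EV_local z v i t m" if "p1 i = 3"
      proof (cases "p1 t")
        case 0
        then show ?thesis using that unfolding EV_local_def v' by (simp add: EV.simps[of z i])
      next
        case (Suc n)
        then show ?thesis using that unfolding EV_local_def v' by (simp add: EV.simps[of z i])
      qed
      ultimately show ?thesis unfolding EV_local_def v' by (auto simp: EV.simps[of z i])
    qed
  qed
next
  assume loc: "\<forall>i t m. EV_local z v i t m"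
  have "\<forall>t. v (pr i t) = EV z i t" for i
  proof (induction i rule: less_induct)
    case (less i)
    consider "p1 i = 0" | "p1 i = 1" | "p1 i = 2" | "p1 i = 3" | "p1 i > 3" by linarith
    then show ?case
    proof cases
      case 1
      then show ?thesis using loc by (simp add: EV_local_def EV.simps[of z i])
    next
      case 2
      then show ?thesis using loc less prod_code_less[of i] by (simp add: EV_local_def EV.simps[of z i])
    next
      case 3
      then show ?thesis using loc less prod_code_less[of i] by (simp add: EV_local_def EV.simps[of z i])
    next
      case 4
      \<comment> \<open>Here the table refers to its own entry at the same index i, so an inner
        induction on the recursion argument is needed.\<close>
      have "v (pr i (pr n t)) = EV z i (pr n t)" for n t
      proof (induction n)
        case 0
        then show ?case using 4 loc[rule_format, of i "pr 0 t"] less prod_code_less[of i]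
          by (simp add: EV_local_def EV.simps[of z i])
      next
        case (Suc n)
        then show ?case using 4 loc[rule_format, of i "pr (Suc n) t"] less prod_code_less[of i]
          by (simp add: EV_local_def EV.simps[of z i])
      qed
      then show ?thesis by (metis prod.collapse prod_decode_inverse)
    next
      case 5
      show ?thesis
      proof
        fix t
        let ?f = "\<lambda>m. EV z (p1 (p2 i)) (pr m t)"
        have f: "v (pr (p1 (p2 i)) s) = EV z (p1 (p2 i)) s" for s
          using less prod_code_less[of i] 5 by simp
        have "v (pr i t) = (if \<exists>m. ?f m = 0 then LEAST m. ?f m = 0 else 0)"
          unfolding least_total_iff using 5 loc[rule_format, of i t] by (simp add: EV_local_def f)
        then show "v (pr i t) = EV z i t" using 5 by (simp add: EV.simps[of z i])
      qed
    qed
  qed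
  then show "is_EV z v" by (simp add: is_EV_def)
qed

lemma sig_is_EV: "sig (\<lambda>X. is_EV (X i) (X j))"
  unfolding is_EV_local EV_local_def base_def
  by (intro sig_all sig_dec cf_intros)

section \<open>Indices of recursive functions and functionals\<close>

primrec enc :: "nat list \<Rightarrow> nat" where
  "enc [] = 0"
| "enc (x # xs) = pr x (enc xs)"

text \<open>Indices are assembled along the inductive definition, independently of the oracle.
  Arguments are nested pairs, so the base functions \<open>p1\<close> and \<open>p2\<close> provide
  the projections; regularity keeps the search away from its default value.\<close>

lemma EV_recursive_fn: "recursive_fn k f \<Longrightarrow> \<exists>i. \<forall>z xs. length xs = k \<longrightarrow> EV z i (enc xs) = f xs"
proof (induction rule: recursive_fn.induct)
  case (zero k)
  show ?case by (rule exI[of _ "pr 0 (pr 0 0)"]) (simp add: EV_base base_def)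
next
  case succ
  show ?case by (rule exI[of _ "pr 1 (pr (pr 0 (pr 1 0)) (pr 0 (pr 2 0)))"])
    (auto simp: EV_comp EV_base base_def length_Suc_conv)
next
  case (proj i k)
  have "\<exists>c. \<forall>z xs. i < length xs \<longrightarrow> EV z c (enc xs) = xs ! i" for i
  proof (induction i)
    case 0
    show ?case
    proof (intro exI[of _ "pr 0 (pr 2 0)"] allI impI)
      fix z and xs :: "nat list" assume "0 < length xs"
      then show "EV z (pr 0 (pr 2 0)) (enc xs) = xs ! 0" by (cases xs) (auto simp: EV_base base_def)
    qed
  next
    case (Suc i)
    then obtain c where c: "\<And>z xs. i < length xs \<Longrightarrow> EV z c (enc xs) = xs ! i" by blast
    show ?case
    proof (intro exI[of _ "pr 1 (pr c (pr 0 (pr 3 0)))"] allI impI)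
      fix z and xs :: "nat list" assume "Suc i < length xs"
      then show "EV z (pr 1 (pr c (pr 0 (pr 3 0)))) (enc xs) = xs ! Suc i"
        by (cases xs) (auto simp: EV_comp EV_base base_def c)
    qed
  qed
  then show ?case using proj by metis
next
  case (comp gs f k)
  have "\<exists>j. \<forall>z xs. length xs = k \<longrightarrow> EV z j (enc xs) = enc (map (\<lambda>g. g xs) hs)" if "set hs \<subseteq> set gs" for hs
    using that
  proof (induction hs)
    case Nil
    show ?case by (rule exI[of _ "pr 0 (pr 0 0)"]) (simp add: EV_base base_def)
  next
    case (Cons h hs)
    then obtain j where j: "\<And>z xs. length xs = k \<Longrightarrow> EV z j (enc xs) = enc (map (\<lambda>g. g xs) hs)" by auto
    obtain l where l: "\<And>z xs. length xs = k \<Longrightarrow> EV z l (enc xs) = h xs"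
      using Cons.prems comp.IH by (metis list.set_intros(1) subsetD)
    show ?case by (rule exI[of _ "pr 2 (pr l j)"]) (simp add: EV_pair j l)
  qed
  then obtain j where j: "\<And>z xs. length xs = k \<Longrightarrow> EV z j (enc xs) = enc (map (\<lambda>g. g xs) gs)" by blast
  obtain l where l: "\<And>z xs. length xs = length gs \<Longrightarrow> EV z l (enc xs) = f xs" using comp.IH by auto
  show ?case by (rule exI[of _ "pr 1 (pr l j)"]) (simp add: EV_comp j l)
next
  case (prim_rec k f g)
  then obtain a b where a: "\<And>z xs. length xs = k \<Longrightarrow> EV z a (enc xs) = f xs"
    and b: "\<And>z xs. length xs = Suc (Suc k) \<Longrightarrow> EV z b (enc xs) = g xs" by blast
  show ?case
  proof (intro exI[of _ "pr 3 (pr a b)"] allI impI)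
    fix z and xs :: "nat list" assume "length xs = Suc k"
    then obtain x ys where xs: "xs = x # ys" "length ys = k" by (auto simp: length_Suc_conv)
    have "EV z b (pr m (pr r (enc ys))) = g (m # r # ys)" for m r
      using b[of "m # r # ys" z] xs by simp
    then show "EV z (pr 3 (pr a b)) (enc xs) = rec_nat (f (tl xs)) (\<lambda>n r. g (n # r # tl xs)) (hd xs)"
      using xs by (simp add: EV_rec a)
  qed
next
  case (minimalization k g)
  then obtain a where a: "\<And>z xs. length xs = Suc k \<Longrightarrow> EV z a (enc xs) = g xs" by blast
  have "EV z a (pr m (enc xs)) = g (m # xs)" if "length xs = k" for z m xs
    using a[of "m # xs" z] that by simp
  then show ?case using minimalization(2) by (intro exI[of _ "pr 4 (pr a 0)"]) (simp add: EV_mu)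
qed

text \<open>Composition and the base function z suffice for oracle queries, because
  \<open>cf\<close> applies recursion to numbers already computed and never to the oracles.\<close>

lemma EV_cf: "cf \<Phi> \<Longrightarrow> \<exists>i. \<forall>z n c. EV z i (pr n c) = \<Phi> (z ## num n ## num c ## (\<lambda>_. num 0))"
proof (induction rule: cf.induct)
  case (app h i)
  then obtain b where b: "\<And>z n c. EV z b (pr n c) = h (z ## num n ## num c ## (\<lambda>_. num 0))" by blast
  consider "i = 0" | "i = 1" | "i = 2" | j where "i = Suc (Suc (Suc j))"
    by (metis One_nat_def not0_implies_Suc numeral_2_eq_2)
  then show ?case
  proof cases
    case 1
    then show ?thesis by (intro exI[of _ "pr 1 (pr (pr 0 (pr 4 0)) b)"]) (simp add: EV_comp EV_base base_def b)
  next
    case 2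
    then show ?thesis by (intro exI[of _ "pr 0 (pr 2 0)"]) (simp add: EV_base base_def)
  next
    case 3
    then show ?thesis by (intro exI[of _ "pr 0 (pr 3 0)"]) (simp add: EV_base base_def numeral_2_eq_2)
  next
    case 4
    then show ?thesis by (intro exI[of _ "pr 0 (pr 0 0)"]) (simp add: EV_base base_def)
  qed
next
  case (rec gs f)
  have "\<exists>j. \<forall>z n c. EV z j (pr n c) = enc (map (\<lambda>g. g (z ## num n ## num c ## (\<lambda>_. num 0))) hs)"
    if "set hs \<subseteq> set gs" for hs
    using that
  proof (induction hs)
    case Nil
    show ?case by (rule exI[of _ "pr 0 (pr 0 0)"]) (simp add: EV_base base_def)
  next
    case (Cons h hs)
    then obtain j where j: "\<And>z n c. EV z j (pr n c) = enc (map (\<lambda>g. g (z ## num n ## num c ## (\<lambda>_. num 0))) hs)"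
      by auto
    obtain l where l: "\<And>z n c. EV z l (pr n c) = h (z ## num n ## num c ## (\<lambda>_. num 0))"
      using Cons.prems rec.IH by (metis list.set_intros(1) subsetD)
    show ?case by (rule exI[of _ "pr 2 (pr l j)"]) (simp add: EV_pair j l)
  qed
  then obtain j where j: "\<And>z n c. EV z j (pr n c) = enc (map (\<lambda>g. g (z ## num n ## num c ## (\<lambda>_. num 0))) gs)"
    by blast
  obtain f' where f': "recursive_fn (length gs) f'" "\<And>xs. length xs = length gs \<Longrightarrow> f' xs = f xs"
    using rec.hyps unfolding recf_def by blast
  obtain l where l: "\<And>z xs. length xs = length gs \<Longrightarrow> EV z l (enc xs) = f' xs"
    using EV_recursive_fn[OF f'(1)] by blast
  show ?case by (rule exI[of _ "pr 1 (pr l j)"]) (simp add: EV_comp j l f'(2))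
qed

section \<open>The two sets\<close>

text \<open>The oracle \<open>w (pr 0 t)\<close> is the actual witness; \<open>w (pr 1 t)\<close> is forced to be the evaluator relative to it.
  Supplying the evaluator makes the family uniformly \<open>\<Pi>\<^sup>0\<^sub>1\<close> without a universal recursive function.\<close>

definition closed_set :: "nat \<Rightarrow> nat \<Rightarrow> baire set" where
  "closed_set a c = {w. is_EV (\<lambda>t. w (pr 0 t)) (\<lambda>t. w (pr 1 t)) \<and> (\<forall>n. w (pr 1 (pr a (pr n c))) = 0)}"

lemma pi_closed_set:
  assumes "cf a" "cf c"
  shows "pi (\<lambda>X. X i \<in> closed_set (a X) (c X))"
proof -
  have "pi (\<lambda>X. is_EV (\<lambda>t. X i (pr 0 t)) (\<lambda>t. X i (pr 1 t)))"
    unfolding is_EV_local EV_local_def base_def by (intro pi_all pi_dec cf_intros)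
  moreover have "pi (\<lambda>X. \<forall>n. X i (pr 1 (pr (a X) (pr n (c X)))) = 0)"
    by (intro pi_all pi_dec cf_intros cf_shift[OF assms(1)] cf_shift[OF assms(2)])
  ultimately show ?thesis by (simp only: closed_set_def mem_Collect_eq pi_conj)
qed

lemma Pi01_closed_set: "Pi01 baire_nbhd (closed_set a c)"
  using pi_Pi01[OF pi_closed_set[where i=0 and a="\<lambda>_. a" and c="\<lambda>_. c"]] by (simp add: cf_const)

lemma is_EV_exists: "is_EV z (\<lambda>p. EV z (p1 p) (p2 p))"
  by (simp add: is_EV_def)

text \<open>Nonemptiness in this family is universal for analytic predicates of a number c: an
  element consists of a witness together with the evaluator table that verifies it.\<close>

lemma closed_set_universal:
  assumes "sig P"
  shows "\<exists>a. \<forall>c. P (\<lambda>i. num (if i = 0 then c else 0)) \<longleftrightarrow> closed_set a c \<noteq> {}"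
proof -
  obtain D where D: "dec D" "\<And>X. P X \<longleftrightarrow> (\<exists>z. \<forall>n. D (z ## num n ## X))"
    using assms unfolding sig_def by blast
  obtain a where a: "\<And>z n c. EV z a (pr n c) = (if D (z ## num n ## num c ## (\<lambda>_. num 0)) then 0 else 1)"
    using EV_cf[OF D(1)[unfolded dec_def]] by blast
  have "P (num c ## (\<lambda>_. num 0)) \<longleftrightarrow> closed_set a c \<noteq> {}" for c
  proof
    assume "P (num c ## (\<lambda>_. num 0))"
    then obtain z where z: "\<And>n. D (z ## num n ## num c ## (\<lambda>_. num 0))" using D(2) by blast
    have "(\<lambda>p. if p1 p = 0 then z (p2 p) else EV z (p1 (p2 p)) (p2 (p2 p))) \<in> closed_set a c"
      by (simp add: closed_set_def is_EV_exists a z)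
    then show "closed_set a c \<noteq> {}" by blast
  next
    assume "closed_set a c \<noteq> {}"
    then obtain w where "is_EV (\<lambda>t. w (pr 0 t)) (\<lambda>t. w (pr 1 t))" "\<And>n. w (pr 1 (pr a (pr n c))) = 0"
      unfolding closed_set_def by blast
    then have "EV (\<lambda>t. w (pr 0 t)) a (pr n c) = 0" for n by (simp add: is_EV_def)
    then have "D ((\<lambda>t. w (pr 0 t)) ## num n ## num c ## (\<lambda>_. num 0))" for n
      by (simp only: a indicator_eq_0)
    then show "P (num c ## (\<lambda>_. num 0))" using D(2) by blast
  qed
  moreover have "(\<lambda>i. num (if i = 0 then c else 0)) = num c ## (\<lambda>_. num 0)" for c
    by (rule ext) (simp split: nat.split)
  ultimately show ?thesis by (intro exI[of _ a]) simp
qed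

section \<open>Analytic graphs and the condition \<open>R\<close>\<close>

definition outside :: "nat \<Rightarrow> baire \<Rightarrow> bool" where
  "outside s x \<longleftrightarrow> (\<exists>i. i < length (list_decode s) \<and> x i \<noteq> lnth s i)"

lemma outside_iff: "outside s x \<longleftrightarrow> x \<notin> baire_nbhd s"
  by (auto simp: outside_def baire_nbhd_def)

lemma sig_outside:
  assumes "cf s" shows "sig (\<lambda>X. outside (s X) (X j))"
  unfolding outside_def
  by (intro sig_exn sig_dec dec_and dec_less dec_not dec_eq cf_1[OF rec1_length] cf_2[OF rec2_lnth]
      cf_shift[OF assms] cf.app cf_const)

text \<open>A projection of the complement of a union of boxes, where e indexes the enumeration of
  the boxes. The code s splits into \<open>p1 s\<close> for a box in the plane of x and y and
  \<open>p2 s\<close> for a cylinder of witnesses z; the table v only serves to evaluate e.\<close>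

definition graph :: "nat \<Rightarrow> baire \<Rightarrow> baire \<Rightarrow> bool" where
  "graph e x y \<longleftrightarrow> (\<exists>z v. is_EV z v \<and> (\<forall>s m. v (pr e (pr s (pr m 0))) = 0 \<longrightarrow>
     outside (p1 (p1 s)) x \<or> outside (p2 (p1 s)) y \<or> outside (p2 s) z))"

lemma sig_graph:
  assumes "cf e" shows "sig (\<lambda>X. graph (e X) (X i) (X j))"
  unfolding graph_def
  by (intro sig_intros sig_and sig_imp sig_or sig_is_EV sig_outside cf_intros cf_shift[OF assms])

lemma Sigma11_graph:
  assumes "Sigma11 (prod_nbhd baire_nbhd baire_nbhd) G"
  shows "\<exists>e. \<forall>x y. (x, y) \<in> G \<longleftrightarrow> graph e x y"
proof -
  obtain C where G: "G = {p. \<exists>z. (p, z) \<in> C}"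
    and C_Pi01: "Pi01 (prod_nbhd (prod_nbhd baire_nbhd baire_nbhd) baire_nbhd) C"
    using assms unfolding Sigma11_def by blast
  obtain W where C: "- C = (\<Union>s\<in>W. prod_nbhd (prod_nbhd baire_nbhd baire_nbhd) baire_nbhd s)"
    and W: "rec_enumerable W"
    using C_Pi01 unfolding Pi01_def Sigma01_def by blast
  obtain f where f: "recursive_fn 2 f" "W = {n. \<exists>m. f [n, m] = 0}"
    using W unfolding rec_enumerable_def by blast
  obtain e where e: "\<And>z xs. length xs = 2 \<Longrightarrow> EV z e (enc xs) = f xs"
    using EV_recursive_fn[OF f(1)] by blast
  have e': "EV z e (pr s (pr m 0)) = f [s, m]" for z s m
    using e[of "[s, m]" z] by simp
  have "((x, y), z) \<in> C \<longleftrightarrow> (\<forall>s m. f [s, m] = 0 \<longrightarrow>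
     outside (p1 (p1 s)) x \<or> outside (p2 (p1 s)) y \<or> outside (p2 s) z)" for x y z
  proof -
    have "((x, y), z) \<in> C \<longleftrightarrow> ((x, y), z) \<notin> - C" by simp
    then show ?thesis unfolding C f(2) outside_iff prod_nbhd_def
      by (simp only: UN_iff mem_Collect_eq mem_Times_iff fst_conv snd_conv) blast
  qed
  then have "(x, y) \<in> G \<longleftrightarrow> (\<exists>z. \<forall>s m. f [s, m] = 0 \<longrightarrow>
     outside (p1 (p1 s)) x \<or> outside (p2 (p1 s)) y \<or> outside (p2 s) z)" for x y
    unfolding G by simp
  moreover have "(\<exists>v. is_EV z v \<and> (\<forall>s m. v (pr e (pr s (pr m 0))) = 0 \<longrightarrow> Q s)) \<longleftrightarrow>
     (\<forall>s m. f [s, m] = 0 \<longrightarrow> Q s)" for z Q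
  proof
    assume "\<exists>v. is_EV z v \<and> (\<forall>s m. v (pr e (pr s (pr m 0))) = 0 \<longrightarrow> Q s)"
    then show "\<forall>s m. f [s, m] = 0 \<longrightarrow> Q s" unfolding is_EV_def by (metis e')
  next
    assume "\<forall>s m. f [s, m] = 0 \<longrightarrow> Q s"
    then show "\<exists>v. is_EV z v \<and> (\<forall>s m. v (pr e (pr s (pr m 0))) = 0 \<longrightarrow> Q s)"
      by (intro exI[of _ "\<lambda>p. EV z (p1 p) (p2 p)"]) (simp add: is_EV_exists e')
  qed
  ultimately show ?thesis unfolding graph_def by (intro exI[of _ e]) simp
qed

text \<open>Coreduction applied to "some value of the relation at x has n-th term m" and "some value
  has another n-th term". The results cover everything for every e, and for the graph of a function
  they are exact complements.\<close>

lemma graph_decider: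
  obtains \<phi> \<psi> :: "nat \<Rightarrow> baire \<Rightarrow> nat \<Rightarrow> nat \<Rightarrow> bool" where
    "\<And>e i n m. cf e \<Longrightarrow> cf n \<Longrightarrow> cf m \<Longrightarrow> sig (\<lambda>X. \<phi> (e X) (X i) (n X) (m X))"
    "\<And>e i n m. cf e \<Longrightarrow> cf n \<Longrightarrow> cf m \<Longrightarrow> sig (\<lambda>X. \<psi> (e X) (X i) (n X) (m X))"
    "\<And>e x n m. \<phi> e x n m \<or> \<psi> e x n m"
    "\<And>e x y n m. (\<And>y'. graph e x y' \<longleftrightarrow> y' = y) \<Longrightarrow> \<phi> e x n m \<longleftrightarrow> y n = m"
    "\<And>e x y n m. (\<And>y'. graph e x y' \<longleftrightarrow> y' = y) \<Longrightarrow> \<psi> e x n m \<longleftrightarrow> y n \<noteq> m"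
proof -
  let ?P = "\<lambda>X. \<exists>y. y (X 2 0) = X 3 0 \<and> graph (X 0 0) (X 1) y"
  let ?Q = "\<lambda>X. \<exists>y. y (X 2 0) \<noteq> X 3 0 \<and> graph (X 0 0) (X 1) y"
  have PQ: "sig ?P" "sig ?Q"
    by (intro sig_ex sig_and sig_graph sig_dec cf_intros)+
  obtain P' Q' where P': "sig P'" "sig Q'" "\<And>X. ?P X \<Longrightarrow> P' X" "\<And>X. ?Q X \<Longrightarrow> Q' X"
    "\<And>X. P' X \<or> Q' X" "\<And>X. P' X \<Longrightarrow> Q' X \<Longrightarrow> ?P X \<and> ?Q X"
    using coreduction[OF PQ] by blast
  let ?\<sigma> = "\<lambda>e x n m. num e ## x ## num n ## num m ## (\<lambda>_. num 0)"
  have sub: "sub (\<lambda>X. ?\<sigma> (e X) (X i) (n X) (m X))" if "cf e" "cf n" "cf m" for e n m i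
    by (intro sub_intros cf_shift[OF that(1)] cf_shift[OF that(2)] cf_shift[OF that(3)] cf_intros)
  have dec: "(P' (?\<sigma> e x n m) \<longleftrightarrow> y n = m) \<and> (Q' (?\<sigma> e x n m) \<longleftrightarrow> y n \<noteq> m)"
    if "\<And>y'. graph e x y' \<longleftrightarrow> y' = y" for e x y n m
  proof -
    have "?P (?\<sigma> e x n m) \<longleftrightarrow> y n = m" "?Q (?\<sigma> e x n m) \<longleftrightarrow> y n \<noteq> m"
      by (simp_all add: that numeral_2_eq_2 numeral_3_eq_3)
    \<comment> \<open>The two predicates are complementary here. Enlargements that add nothing to
      their empty intersection cannot enlarge either of them.\<close>
    then show ?thesis using P'(3-6)[of "?\<sigma> e x n m"] by blast
  qed
  show ?thesis
  proof (rule that[of "\<lambda>e x n m. P' (?\<sigma> e x n m)" "\<lambda>e x n m. Q' (?\<sigma> e x n m)"])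
    show "sig (\<lambda>X. P' (?\<sigma> (e X) (X i) (n X) (m X)))" if "cf e" "cf n" "cf m" for e n m i
      by (rule sig_sub[OF P'(1) sub[OF that]])
    show "sig (\<lambda>X. Q' (?\<sigma> (e X) (X i) (n X) (m X)))" if "cf e" "cf n" "cf m" for e n m i
      by (rule sig_sub[OF P'(2) sub[OF that]])
  qed (use P'(5) dec in blast)+
qed

text \<open>In the definition of \<open>R\<close> below, \<open>e\<close> need not be the index of a graph. Where \<open>\<phi>\<close> and \<open>\<psi>\<close> are
  disjoint they are complements of each other, so totality can be stated with \<open>\<not> \<psi>\<close> and the
  values be named with \<open>\<phi>\<close>, which leaves the condition \<open>\<Sigma>\<^sup>1\<^sub>1\<close>.\<close>

lemma irreducible:
  obtains R :: "nat \<Rightarrow> nat \<Rightarrow> nat \<Rightarrow> bool" where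
    "\<And>a b c. cf a \<Longrightarrow> cf b \<Longrightarrow> cf c \<Longrightarrow> sig (\<lambda>X. R (a X) (b X) (c X))"
    "\<And>a b c. closed_set a c \<noteq> {} \<Longrightarrow> closed_set b c = {} \<Longrightarrow> R a b c"
    "\<And>a b c F. R a b c \<Longrightarrow> Hyp_function F \<Longrightarrow> \<not> F ` closed_set a c \<subseteq> closed_set b c"
proof -
  obtain \<phi> \<psi> :: "nat \<Rightarrow> baire \<Rightarrow> nat \<Rightarrow> nat \<Rightarrow> bool" where
    sig: "\<And>e i n m. cf e \<Longrightarrow> cf n \<Longrightarrow> cf m \<Longrightarrow> sig (\<lambda>X. \<phi> (e X) (X i) (n X) (m X))"
      "\<And>e i n m. cf e \<Longrightarrow> cf n \<Longrightarrow> cf m \<Longrightarrow> sig (\<lambda>X. \<psi> (e X) (X i) (n X) (m X))"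
    and cover: "\<And>e x n m. \<phi> e x n m \<or> \<psi> e x n m"
    and dec: "\<And>e x y n m. (\<And>y'. graph e x y' \<longleftrightarrow> y' = y) \<Longrightarrow> \<phi> e x n m \<longleftrightarrow> y n = m"
      "\<And>e x y n m. (\<And>y'. graph e x y' \<longleftrightarrow> y' = y) \<Longrightarrow> \<psi> e x n m \<longleftrightarrow> y n \<noteq> m"
    by (rule graph_decider) blast
  define R where "R a b c \<longleftrightarrow> (\<forall>e. \<exists>x. x \<in> closed_set a c \<and>
    ((\<exists>n m. \<phi> e x n m \<and> \<psi> e x n m) \<or> (\<exists>n. \<forall>m. \<psi> e x n m) \<or>
     (\<exists>y. (\<forall>n. \<phi> e x n (y n)) \<and> y \<notin> closed_set b c)))" for a b c
  show ?thesis
  proof (rule that[of R])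
    fix a b c assume cf: "cf a" "cf b" "cf c"
    show "sig (\<lambda>X. R (a X) (b X) (c X))"
      unfolding R_def
      by (intro sig_all sig_exn sig_ex sig_and sig_or sig sig_not_pi[OF pi_closed_set] pi_sig[OF pi_closed_set]
        cf_shift[OF cf(1)] cf_shift[OF cf(2)] cf_shift[OF cf(3)] cf.app cf_const)
  next
    fix a b c assume "closed_set a c \<noteq> {}" and b: "closed_set b c = {}"
    then obtain x where x: "x \<in> closed_set a c" by blast
    \<comment> \<open>If every n has some m satisfying \<open>\<phi>\<close>, choice collects such m
      into a real y, and y lies outside the empty set.\<close>
    have "(\<exists>n. \<forall>m. \<psi> e x n m) \<or> (\<exists>y. \<forall>n. \<phi> e x n (y n))" for e
      using cover by metis
    then show "R a b c" unfolding R_def b using x by blast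
  next
    fix a b c F assume R: "R a b c" and F: "Hyp_function F"
    obtain e where e: "\<And>x y. graph e x y \<longleftrightarrow> y = F x"
      using Sigma11_graph F unfolding Hyp_function_def Delta11_def by blast
    have \<phi>: "\<phi> e x n m \<longleftrightarrow> F x n = m" and \<psi>: "\<psi> e x n m \<longleftrightarrow> F x n \<noteq> m" for x n m
      using dec[of e x "F x" n m] e by simp_all
    obtain x where x: "x \<in> closed_set a c" and
      "(\<exists>n m. \<phi> e x n m \<and> \<psi> e x n m) \<or> (\<exists>n. \<forall>m. \<psi> e x n m) \<or>
       (\<exists>y. (\<forall>n. \<phi> e x n (y n)) \<and> y \<notin> closed_set b c)"
      using R[unfolded R_def, rule_format, of e] by blast
    \<comment> \<open>For a genuine graph there is neither an overlap nor a missing value (take m =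
      \<open>F x n\<close>), so only the third alternative survives, and y is
      \<open>F x\<close>.\<close>
    then obtain y where "\<And>n. F x n = y n" "y \<notin> closed_set b c" unfolding \<phi> \<psi> by blast
    moreover from this(1) have "F x = y" by (rule ext)
    ultimately show "\<not> F ` closed_set a c \<subseteq> closed_set b c" using x by blast
  qed
qed

section \<open>The diagonal choice of the pair\<close>

theorem theorem3p1:
  "\<exists>A B :: baire set.
     A \<noteq> {} \<and> B \<noteq> {} \<and> Pi01 baire_nbhd A \<and> Pi01 baire_nbhd B \<and>
     \<not> (\<exists>F. Hyp_function F \<and> F ` A \<subseteq> B) \<and>
     \<not> (\<exists>F. Hyp_function F \<and> F ` B \<subseteq> A)"
proof -
  obtain R where sig_R: "\<And>a b c. cf a \<Longrightarrow> cf b \<Longrightarrow> cf c \<Longrightarrow> sig (\<lambda>X. R (a X) (b X) (c X))"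
    and R_empty: "\<And>a b c. closed_set a c \<noteq> {} \<Longrightarrow> closed_set b c = {} \<Longrightarrow> R a b c"
    and R_Hyp: "\<And>a b c F. R a b c \<Longrightarrow> Hyp_function F \<Longrightarrow> \<not> F ` closed_set a c \<subseteq> closed_set b c"
    using irreducible by blast
  have "sig (\<lambda>X. R (p1 (X 0 0)) (p2 (X 0 0)) (X 0 0))" "sig (\<lambda>X. R (p2 (X 0 0)) (p1 (X 0 0)) (X 0 0))"
    by (intro sig_R cf_intros)+
  then obtain U V where U: "sig U" "sig V"
    "\<And>X. R (p1 (X 0 0)) (p2 (X 0 0)) (X 0 0) \<Longrightarrow> U X" "\<And>X. R (p2 (X 0 0)) (p1 (X 0 0)) (X 0 0) \<Longrightarrow> V X"
    "\<And>X. U X \<or> V X"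
    "\<And>X. U X \<Longrightarrow> V X \<Longrightarrow> R (p1 (X 0 0)) (p2 (X 0 0)) (X 0 0) \<and> R (p2 (X 0 0)) (p1 (X 0 0)) (X 0 0)"
    by (rule coreduction) blast
  \<comment> \<open>The indices are crossed: nonemptiness of the first set is tied to
    \<open>V\<close> and that of the second to \<open>U\<close>.\<close>
  obtain a where a: "\<And>c. V (\<lambda>i. num (if i = 0 then c else 0)) \<longleftrightarrow> closed_set a c \<noteq> {}"
    using closed_set_universal[OF U(2)] by blast
  obtain b where b: "\<And>c. U (\<lambda>i. num (if i = 0 then c else 0)) \<longleftrightarrow> closed_set b c \<noteq> {}"
    using closed_set_universal[OF U(1)] by blast
  \<comment> \<open>The parameter c codes both indices, so the predicates defining the two sets at c
    speak about these same two sets.\<close>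
  define c where "c = pr a b"
  let ?X = "\<lambda>i. num (if i = 0 then c else 0)"
  have UV: "R a b c \<Longrightarrow> U ?X" "R b a c \<Longrightarrow> V ?X" "U ?X \<or> V ?X" "U ?X \<Longrightarrow> V ?X \<Longrightarrow> R a b c \<and> R b a c"
    using U(3-6)[of ?X] by (simp_all add: c_def)
  \<comment> \<open>If \<open>U\<close> failed, the second set would be empty and, by covering, the
    first nonempty; then \<open>R a b c\<close> would hold and force \<open>U\<close>.\<close>
  have "U ?X"
    using UV(1,3) R_empty[of a c b] a[of c] b[of c] by argo
  moreover have "V ?X"
    using UV(2,3) R_empty[of b c a] a[of c] b[of c] by argo
  ultimately have ne: "closed_set a c \<noteq> {}" "closed_set b c \<noteq> {}" and "R a b c" "R b a c"
    using UV(4) a[of c] b[of c] by simp_all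
  then have "\<not> (\<exists>F. Hyp_function F \<and> F ` closed_set a c \<subseteq> closed_set b c)"
    "\<not> (\<exists>F. Hyp_function F \<and> F ` closed_set b c \<subseteq> closed_set a c)"
    using R_Hyp by metis+
  with ne show ?thesis using Pi01_closed_set by metis
qed

end
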